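(* Let $m>1$. Then for any $\gamma\in\mathbb{R}$ the boundary value problem $$f'''+(m+2)ff''-(2m+1)f'^2=0 \text{ on } [0,\infty),\qquad f(0)=-\gamma,\quad f''(0)=-1,\quad f'(\infty)=0$$ has infinitely many concave-convex solutions.
   Context: Here $f'(\infty):=\lim_{t\to\infty}f'(t)$. A solution is a three times differentiable function $f:[0,\infty)\to\mathbb{R}$ satisfying the differential equation on $[0,\infty)$ together with all three boundary conditions; $f'(0)$ is not prescribed. A solution $f$ is concave-convex if there is $t_0>0$ with $f''<0$ on $[0,t_0)$, $f''(t_0)=0$ and $f''>0$ on $(t_0,\infty)$. *)

theory Defs
  imports "HOL-Analysis.Analysis"
begin

(* Derivative of a function on the half-line [0,\<infinity>), one-sided at 0.  At negative t
   the value carries no information. *)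
definition half_line_deriv :: "(real \<Rightarrow> real) \<Rightarrow> real \<Rightarrow> real" where
  "half_line_deriv f t = vector_derivative f (at t within {0..})"

definition three_times_differentiable :: "(real \<Rightarrow> real) \<Rightarrow> bool" where
  "three_times_differentiable f \<longleftrightarrow>
     (\<forall>k<3. (half_line_deriv ^^ k) f differentiable_on {0..})"

(* A function [0,\<infinity>) \<Rightarrow> \<real> is a total function taking the fixed value undefined at
   negative arguments (the set extensional {0..}), so two solutions that differ as HOL functions
   differ somewhere on [0,\<infinity>); without this, counting solutions would be meaningless. *)
definition bvp_solution :: "real \<Rightarrow> real \<Rightarrow> (real \<Rightarrow> real) \<Rightarrow> bool" where
  "bvp_solution m \<gamma> f \<longleftrightarrow>
     f \<in> extensional {0..} \<and>
     three_times_differentiable f \<and>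
     (\<forall>t\<ge>0. (half_line_deriv ^^ 3) f t + (m + 2) * f t * (half_line_deriv ^^ 2) f t
              - (2 * m + 1) * (half_line_deriv f t)\<^sup>2 = 0) \<and>
     f 0 = - \<gamma> \<and>
     (half_line_deriv ^^ 2) f 0 = - 1 \<and>
     (half_line_deriv f \<longlongrightarrow> 0) at_top"

definition concave_convex :: "(real \<Rightarrow> real) \<Rightarrow> bool" where
  "concave_convex f \<longleftrightarrow>
     (\<exists>t\<^sub>0>0. (\<forall>t\<in>{0..<t\<^sub>0}. (half_line_deriv ^^ 2) f t < 0) \<and>
            (half_line_deriv ^^ 2) f t\<^sub>0 = 0 \<and>
            (\<forall>t>t\<^sub>0. (half_line_deriv ^^ 2) f t > 0))"

end

theory Submission
  imports Defs
begin

text \<open>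
Write \<open>g = f'\<close>, \<open>h = f''\<close>, \<open>c = m + 2\<close>, \<open>b = 2m + 1\<close>; then \<open>2c = b + 3\<close>, and \<open>m > 1\<close> means \<open>b > c\<close>.
Shoot from \<open>t = 0\<close> with the slope \<open>a = g 0\<close> as parameter. Let \<open>B\<close> be the set of slopes for which \<open>g\<close>
becomes negative while \<open>h\<close> is still negative. It is open, contains all negative slopes and is bounded
above, so it has no maximum and infinitely many of its points lie just below \<open>A = Sup B\<close>. The orbit
of \<open>A\<close> itself satisfies \<open>g > 0 > h\<close> forever, with \<open>f\<close> eventually positive and \<open>h\<close> becoming
arbitrarily small. For \<open>a \<in> B\<close> close to \<open>A\<close> the orbit therefore passes a time at which
\<open>- g / f\<^sup>2 - h / f ^ 3\<close> is small, and this quantity does not increase as long as \<open>h \<le> 0\<close>; hence \<open>h\<close> vanishes at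
some point with \<open>g < 0 < f\<close> and \<open>- g / f\<^sup>2\<close> small. From there on \<open>h > 0\<close>, and \<open>f\<close> stays positive and
decreasing: after an initial phase, in which \<open>f\<close> loses at most a fixed fraction of its value, the orbit
enters the region \<open>h\<^sup>2 + c f g h < b g ^ 3\<close>, which is invariant because \<open>b > c\<close>. A positive decreasing convex
function has slope tending to \<open>0\<close>.
\<close>

section \<open>Monotonicity and differential inequalities\<close>

text \<open>The equation is invariant under passing from \<open>f t\<close> to
  \<open>l * f (l * t)\<close>. Nothing fixes the size of \<open>f\<close> when the orbit starts to
  descend, so smallness has to be measured by the invariants \<open>g / f\<^sup>2\<close>,
  \<open>h / f ^ 3\<close>, \<open>h / (f * g)\<close> and \<open>f * h / g\<^sup>2\<close>, and
  every estimate below is an inequality between these. The obstacle is that membership in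
  \<open>B\<close> says nothing about the sign of \<open>f\<close> when \<open>h\<close> reaches 0,
  while the trap needs \<open>f > 0\<close> there and \<open>- g / f\<^sup>2\<close> small.
  Closeness to \<open>A\<close> supplies this: the critical orbit is not one of the solutions
  counted, it only guides its neighbours to a time with \<open>f > 0\<close>, \<open>g > 0\<close>
  and \<open>- h / f ^ 3\<close> as small as desired. The second obstacle is that the right-hand
  side is quadratic, so that no orbit is known to be global in advance. Each phase is therefore
  proved on compact intervals, mostly by continuous induction, and global existence comes afterwards
  from the bounds so obtained.\<close>

lemma nondecreasing_within:
  fixes F :: "real \<Rightarrow> real"
  assumes "a \<le> b"
    and D: "\<And>t. t \<in> {a..b} \<Longrightarrow> (F has_real_derivative F' t) (at t within {a..b})"
    and nonneg: "\<And>t. t \<in> {a..b} \<Longrightarrow> F' t \<ge> 0"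
  shows "F a \<le> F b"
proof (rule DERIV_nonneg_imp_increasing_open[OF \<open>a \<le> b\<close>])
  show "continuous_on {a..b} F"
    using D by (meson DERIV_continuous_on)
  show "\<exists>y. DERIV F x :> y \<and> y \<ge> 0" if "a < x" "x < b" for x
    using D[of x] nonneg[of x] that by (auto simp: at_within_Icc_at)
qed

lemma nonincreasing_within:
  fixes F :: "real \<Rightarrow> real"
  assumes "a \<le> b"
    and "\<And>t. t \<in> {a..b} \<Longrightarrow> (F has_real_derivative F' t) (at t within {a..b})"
    and "\<And>t. t \<in> {a..b} \<Longrightarrow> F' t \<le> 0"
  shows "F b \<le> F a"
  using nondecreasing_within[of a b "\<lambda>t. - F t" "\<lambda>t. - F' t"] assms
  by (auto intro: DERIV_minus)

lemma increment_ge_within: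
  fixes F :: "real \<Rightarrow> real"
  assumes "a \<le> b"
    and "\<And>t. t \<in> {a..b} \<Longrightarrow> (F has_real_derivative F' t) (at t within {a..b})"
    and "\<And>t. t \<in> {a..b} \<Longrightarrow> F' t \<ge> k"
  shows "F a + k * (b - a) \<le> F b"
proof -
  have "F a - k * a \<le> F b - k * b"
    by (rule nondecreasing_within[where F' = "\<lambda>t. F' t - k"])
       (use assms in \<open>auto intro!: derivative_eq_intros\<close>)
  then show ?thesis by (simp add: algebra_simps)
qed

lemma increment_le_within:
  fixes F :: "real \<Rightarrow> real"
  assumes "a \<le> b"
    and "\<And>t. t \<in> {a..b} \<Longrightarrow> (F has_real_derivative F' t) (at t within {a..b})"
    and "\<And>t. t \<in> {a..b} \<Longrightarrow> F' t \<le> k"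
  shows "F b \<le> F a + k * (b - a)"
proof -
  have "- F a + (- k) * (b - a) \<le> - F b"
    by (rule increment_ge_within[where F' = "\<lambda>t. - F' t"]) (use assms in \<open>auto intro: DERIV_minus\<close>)
  then show ?thesis by simp
qed

section \<open>First exit times and continuous induction\<close>

lemma ex_first_nonpos:
  fixes h :: "real \<Rightarrow> real"
  assumes "continuous_on {a..b} h" "s \<in> {a..b}" "h s \<le> 0"
  obtains t where "t \<in> {a..s}" "h t \<le> 0" "\<And>r. r \<in> {a..<t} \<Longrightarrow> h r > 0"
proof -
  let ?Z = "{t \<in> {a..b}. h t \<le> 0}"
  have "closed ?Z"
    using assms(1) by (intro continuous_closed_preimage_constant continuous_on_closed_Collect_le
        continuous_on_const) auto
  moreover have "bdd_below ?Z" by (auto intro!: bdd_belowI[of _ a])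
  moreover have ne: "?Z \<noteq> {}" using assms by auto
  ultimately have I: "Inf ?Z \<in> ?Z" by (intro closed_contains_Inf)
  have le: "Inf ?Z \<le> r" if "r \<in> ?Z" for r
    using that by (intro cInf_lower) (auto intro!: bdd_belowI[of _ a])
  show ?thesis
  proof (rule that[of "Inf ?Z"])
    show "Inf ?Z \<in> {a..s}" using I le[of s] assms by auto
    show "h r > 0" if "r \<in> {a..<Inf ?Z}" for r
      using le[of r] that I by (rule_tac ccontr) auto
  qed (use I in auto)
qed

lemma first_zero:
  fixes m :: "real \<Rightarrow> real"
  assumes cont: "continuous_on {a..b} m" and "m a > 0" and w: "w \<in> {a..b}" "m w \<le> 0"
  obtains u where "a < u" "u \<le> w" "m u = 0" "\<And>r. r \<in> {a..<u} \<Longrightarrow> m r > 0"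
proof -
  obtain u where u: "u \<in> {a..w}" "m u \<le> 0" "\<And>r. r \<in> {a..<u} \<Longrightarrow> m r > 0"
    using ex_first_nonpos[OF cont w] by blast
  have "m u = 0"
  proof (rule ccontr)
    assume "m u \<noteq> 0"
    then have "m u < 0" using u(2) by simp
    then obtain x where "a \<le> x" "x \<le> u" "m x = 0"
      using IVT2'[of m u 0 a] assms(2) u(1) continuous_on_subset[OF cont, of "{a..u}"] w by auto
    then show False using u(3)[of x] \<open>m u < 0\<close> by (cases "x = u") auto
  qed
  moreover have "u \<noteq> a" using \<open>m u = 0\<close> assms(2) by auto
  ultimately show ?thesis using u by (intro that[of u]) auto
qed

lemma continuous_pos_lower_bound:
  fixes m :: "real \<Rightarrow> real"
  assumes "continuous_on {a..b} m" "a \<le> b" "\<And>t. t \<in> {a..b} \<Longrightarrow> m t > 0"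
  obtains e where "e > 0" "\<And>t. t \<in> {a..b} \<Longrightarrow> e \<le> m t"
proof -
  obtain x where "x \<in> {a..b}" "\<And>t. t \<in> {a..b} \<Longrightarrow> m x \<le> m t"
    using continuous_attains_inf[of "{a..b}" m] assms by auto
  then show ?thesis using assms(3)[of x] by (intro that[of "m x"]) auto
qed

text \<open>Bootstrap principle: the weak inequality on all of \<open>{a..t}\<close> has to improve
  itself to the strict one at \<open>t\<close>. At the first failure \<open>r\<close> continuity
  from the left still gives \<open>h r \<ge> 0\<close>, so the step applies at \<open>r\<close>
  itself. With \<open>h\<close> a minimum of several margins, estimates that presuppose each other
  are proved together.\<close>

lemma continuous_induction_pos:
  fixes h :: "real \<Rightarrow> real"
  assumes cont: "continuous_on {a..b} h"
    and init: "h a > 0"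
    and step: "\<And>t. t \<in> {a..b} \<Longrightarrow> (\<And>s. s \<in> {a..t} \<Longrightarrow> h s \<ge> 0) \<Longrightarrow> h t > 0"
    and "t \<in> {a..b}"
  shows "h t > 0"
proof (rule ccontr)
  assume "\<not> h t > 0"
  then obtain r where r: "r \<in> {a..t}" "h r \<le> 0" "\<And>s. s \<in> {a..<r} \<Longrightarrow> h s > 0"
    using ex_first_nonpos[OF cont \<open>t \<in> {a..b}\<close>] by (metis not_less)
  have "h r \<ge> 0"
  proof (cases "r = a")
    case True
    then show ?thesis using init by simp
  next
    case False
    then have "a < r" using r by auto
    have "continuous_on {a..r} h" using cont by (rule continuous_on_subset) (use r assms in auto)
    then have "(h \<longlongrightarrow> h r) (at r within {a..r})" using \<open>a < r\<close> by (auto simp: continuous_on_def)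
    then have "(h \<longlongrightarrow> h r) (at_left r)"
      using \<open>a < r\<close> by (simp add: at_within_Icc_at_left)
    moreover have "eventually (\<lambda>s. h s \<ge> 0) (at_left r)"
      using eventually_at_left_real[OF \<open>a < r\<close>] by eventually_elim (use r(3) in \<open>force intro: less_imp_le\<close>)
    ultimately show ?thesis by (rule tendsto_lowerbound) auto
  qed
  then have "h s \<ge> 0" if "s \<in> {a..r}" for s
    using r(3)[of s] that by (cases "s = r") auto
  then have "h r > 0" using step[of r] r(1) assms(4) by auto
  with r show False by simp
qed

lemma same_sign_within:
  fixes g :: "real \<Rightarrow> real"
  assumes "continuous_on {a..b} g" "g a < 0" "\<And>t. t \<in> {a..b} \<Longrightarrow> g t \<noteq> 0" "t \<in> {a..b}"
  shows "g t < 0"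
proof (rule ccontr)
  assume "\<not> g t < 0"
  moreover have "continuous_on {a..t} g"
    using assms by (auto intro: continuous_on_subset)
  ultimately obtain x where "a \<le> x" "x \<le> t" "g x = 0"
    using IVT'[of g a 0 t] assms by auto
  with assms show False by auto
qed

text \<open>Integrating factor: \<open>y\<close> times the exponential of the integral of
  \<open>k\<close> is nondecreasing. The second initial case serves at an inflection point, where
  \<open>h\<close> starts from 0 and only its derivative is positive.\<close>

lemma linear_inequality_pos:
  fixes y k r :: "real \<Rightarrow> real"
  assumes "a \<le> b" and cont: "continuous_on {a..b} k"
    and D: "\<And>t. t \<in> {a..b} \<Longrightarrow> (y has_real_derivative r t - k t * y t) (at t within {a..b})"
    and r: "\<And>t. t \<in> {a..b} \<Longrightarrow> r t \<ge> 0"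
    and init: "y a > 0 \<or> y a = 0 \<and> r a > 0 \<and> a < b"
  shows "y b > 0"
proof -
  define K where "K t = integral {a..t} k" for t
  have K: "(K has_real_derivative k t) (at t within {a..b})" if "t \<in> {a..b}" for t
    unfolding K_def using integral_has_real_derivative[OF cont that] .
  define Y where "Y t = y t * exp (K t)" for t
  have Y: "(Y has_real_derivative r t * exp (K t)) (at t within {a..b})" if "t \<in> {a..b}" for t
    unfolding Y_def
    by (rule derivative_eq_intros D[OF that] K[OF that] refl)+ (simp add: algebra_simps)
  have mono: "Y s \<le> Y t" if "a \<le> s" "s \<le> t" "t \<le> b" for s t
    by (rule nondecreasing_within[where F' = "\<lambda>t. r t * exp (K t)"])
       (use that r in \<open>auto intro: DERIV_subset[OF Y]\<close>)
  have "Y b > 0"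
  proof (cases "y a > 0")
    case True
    then have "Y a > 0" by (simp add: Y_def)
    then show ?thesis using mono[of a b] \<open>a \<le> b\<close> by simp
  next
    case False
    then have *: "y a = 0" "r a > 0" "a < b" using init by auto
    then have "r a * exp (K a) > 0" by simp
    from has_real_derivative_pos_inc_right[OF Y this]
    obtain d where "d > 0" and d: "\<And>h. h > 0 \<Longrightarrow> a + h \<in> {a..b} \<Longrightarrow> h < d \<Longrightarrow> Y a < Y (a + h)"
      using * by auto
    define h where "h = min (d / 2) (b - a)"
    have "h > 0" "h < d" "a + h \<in> {a..b}" using * \<open>d > 0\<close> by (auto simp: h_def)
    then have "Y a < Y (a + h)" "Y (a + h) \<le> Y b" using d[of h] mono[of "a + h" b] by auto
    moreover have "Y a = 0" by (simp add: Y_def *)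
    ultimately show ?thesis by simp
  qed
  then show ?thesis by (simp add: Y_def zero_less_mult_iff)
qed

lemma neg_ratio_le_iff:
  fixes f g k :: real
  assumes "f > 0"
  shows "- g / f\<^sup>2 \<le> k \<longleftrightarrow> - g \<le> k * f\<^sup>2"
  by (rule pos_divide_le_eq) (use assms in simp)

section \<open>Autonomous differential equations\<close>

definition solves :: "('a::real_normed_vector \<Rightarrow> 'a) \<Rightarrow> real set \<Rightarrow> (real \<Rightarrow> 'a) \<Rightarrow> bool" where
  "solves X I x \<longleftrightarrow> (\<forall>t\<in>I. (x has_vector_derivative X (x t)) (at t within I))"

lemma solves_subset: "solves X I x \<Longrightarrow> J \<subseteq> I \<Longrightarrow> solves X J x"
  unfolding solves_def by (meson has_vector_derivative_within_subset subsetD)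

lemma solves_continuous_on: "solves X I x \<Longrightarrow> continuous_on I x"
  unfolding solves_def
  by (meson continuous_on_eq_continuous_within has_vector_derivative_continuous)

lemma solves_cong: "solves X I x \<Longrightarrow> (\<And>t. t \<in> I \<Longrightarrow> y t = x t) \<Longrightarrow> solves X I y"
  unfolding solves_def by (metis has_vector_derivative_transform)

lemma has_integral_exp_scaled:
  fixes L t :: real
  assumes "L > 0" "t \<ge> 0"
  shows "((\<lambda>s. exp (2 * L * s)) has_integral (exp (2 * L * t) - 1) / (2 * L)) {0..t}"
proof -
  have "((\<lambda>s. exp (2 * L * s)) has_integral
      exp (2 * L * t) / (2 * L) - exp (2 * L * 0) / (2 * L)) {0..t}"
    by (rule fundamental_theorem_of_calculus)
       (use assms in \<open>auto simp flip: has_real_derivative_iff_has_vector_derivative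
          intro!: derivative_eq_intros\<close>)
  then show ?thesis by (simp add: diff_divide_distrib)
qed

text \<open>The weight \<open>exp (- 2 L t)\<close> makes the Picard operator a contraction on the whole
  half-line at once.\<close>

lemma picard_global:
  fixes X :: "'a::euclidean_space \<Rightarrow> 'a"
  assumes lip: "L-lipschitz_on UNIV X"
  obtains x where "x 0 = x0" "solves X {0..} x"
proof -
  \<comment> \<open>\<open>L\<close> may be 0, and the integral of the weight is divided by
    \<open>2 * M\<close>.\<close>
  define M where "M = max L 1"
  have M: "M > 0" "M-lipschitz_on UNIV X"
    using lip by (auto simp: M_def intro: lipschitz_on_mono)
  have contX: "continuous_on UNIV X" using lip by (rule lipschitz_on_continuous_on)
  have X_diff: "norm (X u - X v) \<le> M * norm (u - v)" for u v
    using lipschitz_on_normD[OF M(2)] by simp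
  define w where "w s = exp (2 * M * s)" for s
  \<comment> \<open>The unknown is the bounded function \<open>y\<close>; the solution itself is
    \<open>w s *\<^sub>R y s\<close> and may grow like \<open>w\<close>.\<close>
  define P where "P y t = x0 + integral {0..t} (\<lambda>s. X (w s *\<^sub>R apply_bcontfun y s))" for y and t
  have [continuous_intros]: "continuous_on S w" for S
    unfolding w_def by (intro continuous_intros)
  have contXy: "continuous_on S (\<lambda>s. X (w s *\<^sub>R apply_bcontfun y s))" for S and y :: "real \<Rightarrow>\<^sub>C 'a"
    by (rule continuous_on_compose2[OF contX]) (auto intro!: continuous_intros)
  have intXy: "(\<lambda>s. X (w s *\<^sub>R apply_bcontfun y s)) integrable_on {0..t}" for t and y :: "real \<Rightarrow>\<^sub>C 'a"
    by (intro integrable_continuous_real contXy)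
  have w_int: "(w has_integral (w t - 1) / (2 * M)) {0..t}" if "t \<ge> 0" for t
    unfolding w_def using has_integral_exp_scaled[OF M(1) that] by simp
  have wpos: "w t > 0" "w t \<noteq> 0" for t by (auto simp: w_def)
  have winv: "exp (- 2 * M * t) = inverse (w t)" for t by (simp add: w_def exp_minus)
  have P_diff: "norm (P y t - P z t) \<le> w t * (dist y z / 2)" if "t \<ge> 0" for t and y z :: "real \<Rightarrow>\<^sub>C 'a"
  proof -
    have "norm (P y t - P z t) = norm (integral {0..t} (\<lambda>s. X (w s *\<^sub>R y s) - X (w s *\<^sub>R z s)))"
      unfolding P_def by (simp add: integral_diff[OF intXy intXy])
    also have "\<dots> \<le> integral {0..t} (\<lambda>s. M * dist y z * w s)"
    proof (rule integral_norm_bound_integral)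
      show "(\<lambda>s. X (w s *\<^sub>R y s) - X (w s *\<^sub>R z s)) integrable_on {0..t}"
        by (intro integrable_diff intXy)
      show "(\<lambda>s. M * dist y z * w s) integrable_on {0..t}"
        by (intro integrable_continuous_real continuous_intros)
      fix s
      have "norm (X (w s *\<^sub>R y s) - X (w s *\<^sub>R z s)) \<le> M * norm (w s *\<^sub>R (y s - z s))"
        using X_diff by (metis scaleR_diff_right)
      also have "\<dots> = M * (w s * dist (y s) (z s))"
        using wpos[of s] by (simp add: dist_norm)
      also have "\<dots> \<le> M * (w s * dist y z)"
        using M wpos[of s] dist_bounded[of y s z] by (intro mult_left_mono) auto
      finally show "norm (X (w s *\<^sub>R y s) - X (w s *\<^sub>R z s)) \<le> M * dist y z * w s" by (simp add: mult_ac)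
    qed
    also have "\<dots> = M * dist y z * ((w t - 1) / (2 * M))"
      using w_int[OF that] by (simp add: integral_unique)
    also have "\<dots> \<le> w t * (dist y z / 2)"
      using M by (simp add: field_simps)
    finally show ?thesis .
  qed
  have P_zero: "norm (P 0 t) \<le> w t * (norm x0 + norm (X 0) / (2 * M))" if "t \<ge> 0" for t
  proof -
    have "1 + 2 * M * t \<le> w t" unfolding w_def using exp_ge_add_one_self[of "2 * M * t"] by simp
    then have t: "t \<le> w t / (2 * M)" using M by (simp add: field_simps)
    have "norm (P 0 t) \<le> norm x0 + t * norm (X 0)"
      unfolding P_def using that by (intro order_trans[OF norm_triangle_ineq]) simp
    also have "\<dots> \<le> w t * norm x0 + w t / (2 * M) * norm (X 0)"
    proof (intro add_mono mult_right_mono t)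
      have "w t \<ge> 1" using that M by (simp add: w_def)
      then show "norm x0 \<le> w t * norm x0" using mult_right_mono[of 1 "w t" "norm x0"] by simp
    qed auto
    finally show ?thesis by (simp add: algebra_simps)
  qed
  have contP: "continuous_on {0..} (P y)" for y :: "real \<Rightarrow>\<^sub>C 'a"
    unfolding continuous_on_eq_continuous_within
  proof
    fix t :: real assume t: "t \<in> {0..}"
    have "continuous_on {0..t+1} (P y)"
      unfolding P_def by (intro continuous_intros indefinite_integral_continuous_1 intXy)
    then have "continuous (at t within {0..t+1}) (P y)" using t by (auto simp: continuous_on_eq_continuous_within)
    moreover have "at t within {0..} = at t within {0..t+1}"
      by (rule at_within_nhd[of _ "{..<t+1}"]) auto
    ultimately show "continuous (at t within {0..}) (P y)" by simp
  qed
  \<comment> \<open>Bounded continuous functions live on the whole line, so the operator is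
    continued by a constant to negative times.\<close>
  define \<Phi> where "\<Phi> y t = inverse (w (max 0 t)) *\<^sub>R P y (max 0 t)" for y t
  have \<Phi>_mem: "\<Phi> y \<in> bcontfun" for y
  proof (rule bcontfun_normI)
    show "continuous_on UNIV (\<Phi> y)"
    proof -
      have "continuous_on UNIV (\<lambda>t. inverse (w (max 0 t)))"
        unfolding w_def by (intro continuous_intros) auto
      moreover have "continuous_on UNIV (\<lambda>t. P y (max 0 t))"
        by (rule continuous_on_compose2[OF contP[of y]]) (auto intro!: continuous_intros)
      ultimately show ?thesis unfolding \<Phi>_def by (rule continuous_on_scaleR)
    qed
    fix t :: real
    let ?t = "max 0 t"
    have "norm (P y ?t) \<le> norm (P y ?t - P 0 ?t) + norm (P 0 ?t)"
      using norm_triangle_ineq[of "P y ?t - P 0 ?t" "P 0 ?t"] by simp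
    also have "\<dots> \<le> w ?t * (dist y 0 / 2) + w ?t * (norm x0 + norm (X 0) / (2 * M))"
      by (intro add_mono P_zero P_diff) auto
    finally show "norm (\<Phi> y t) \<le> dist y 0 / 2 + (norm x0 + norm (X 0) / (2 * M))"
      using wpos[of ?t] by (simp add: \<Phi>_def divide_simps algebra_simps)
  qed
  have "\<exists>!y. Bcontfun (\<Phi> y) = y"
  proof (rule banach_fix_type[of "1/2"]; (intro allI)?)
    fix y z :: "real \<Rightarrow>\<^sub>C 'a"
    show "dist (Bcontfun (\<Phi> y)) (Bcontfun (\<Phi> z)) \<le> 1 / 2 * dist y z"
    proof (rule dist_bound)
      fix t :: real
      let ?t = "max 0 t"
      have "dist (\<Phi> y t) (\<Phi> z t) = inverse (w ?t) * norm (P y ?t - P z ?t)"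
        using wpos[of ?t] by (simp add: \<Phi>_def dist_norm flip: scaleR_diff_right)
      also have "\<dots> \<le> inverse (w ?t) * (w ?t * (dist y z / 2))"
        using wpos[of ?t] by (intro mult_left_mono P_diff) auto
      also have "\<dots> = 1 / 2 * dist y z" using wpos(2)[of ?t] by simp
      finally show "dist (Bcontfun (\<Phi> y) t) (Bcontfun (\<Phi> z) t) \<le> 1 / 2 * dist y z"
        by (simp only: Bcontfun_inverse \<Phi>_mem)
    qed
  qed auto
  then obtain y where "Bcontfun (\<Phi> y) = y" by auto
  then have fp: "apply_bcontfun y = \<Phi> y" using Bcontfun_inverse[OF \<Phi>_mem, of y] by simp
  have "w t *\<^sub>R y t = P y t" if "t \<ge> 0" for t
    using that wpos[of t] by (subst fp) (simp add: \<Phi>_def)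
  then have wy: "P y t = w t *\<^sub>R y t" if "t \<ge> 0" for t using that by simp
  show ?thesis
  proof (rule that[of "P y"])
    show "P y 0 = x0" by (simp add: P_def)
    show "solves X {0..} (P y)"
      unfolding solves_def
    proof
      fix t :: real assume "t \<in> {0..}"
      then have "(P y has_vector_derivative X (w t *\<^sub>R y t)) (at t within {0..t+1})"
        unfolding P_def
        using integral_has_vector_derivative[OF contXy, of t 0 "t+1" y]
        by (auto intro!: derivative_eq_intros)
      moreover have "at t within {0..} = at t within {0..t+1}"
        by (rule at_within_nhd[of _ "{..<t+1}"]) auto
      ultimately show "(P y has_vector_derivative X (P y t)) (at t within {0..})"
        using wy[of t] \<open>t \<in> {0..}\<close> by simp
    qed
  qed
qed

text \<open>The squared distance is differentiable even where the distance is not, and by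
  Cauchy-Schwarz its derivative is at most \<open>2 * L\<close> times itself in absolute value.
  Using both signs makes the estimate run backward in time as well.\<close>

lemma gronwall_two_sided:
  fixes X :: "'a::real_inner \<Rightarrow> 'a"
  assumes x: "solves X {0..T} x" and y: "solves X {0..T} y"
    and lip: "L-lipschitz_on K X"
    and K: "\<And>t. t \<in> {0..T} \<Longrightarrow> x t \<in> K \<and> y t \<in> K"
    and "T \<ge> 0"
  shows "norm (x T - y T) \<le> exp (L * T) * norm (x 0 - y 0)"
    and "norm (x 0 - y 0) \<le> exp (L * T) * norm (x T - y T)"
proof -
  define D where "D t = (norm (x t - y t))\<^sup>2" for t
  define D' where "D' t = 2 * ((X (x t) - X (y t)) \<bullet> (x t - y t))" for t
  have D: "(D has_real_derivative D' t) (at t within {0..T})" if "t \<in> {0..T}" for t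
  proof -
    have "((\<lambda>t. (x t - y t)) has_vector_derivative (X (x t) - X (y t))) (at t within {0..T})"
      using x y that by (auto simp: solves_def intro: has_vector_derivative_diff)
    then have "((\<lambda>t. (x t - y t) \<bullet> (x t - y t)) has_vector_derivative
        (x t - y t) \<bullet> (X (x t) - X (y t)) + (X (x t) - X (y t)) \<bullet> (x t - y t)) (at t within {0..T})"
      using bounded_bilinear.has_vector_derivative[OF bounded_bilinear_inner] by blast
    then show ?thesis
      by (simp add: D_def[abs_def] D'_def power2_norm_eq_inner inner_commute
          has_real_derivative_iff_has_vector_derivative)
  qed
  have D'_le: "\<bar>D' t\<bar> \<le> 2 * L * D t" if "t \<in> {0..T}" for t
  proof -
    have "\<bar>(X (x t) - X (y t)) \<bullet> (x t - y t)\<bar> \<le> norm (X (x t) - X (y t)) * norm (x t - y t)"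
      by (rule Cauchy_Schwarz_ineq2)
    also have "\<dots> \<le> L * norm (x t - y t) * norm (x t - y t)"
      using lipschitz_on_normD[OF lip, of "x t" "y t"] K[OF that] by (intro mult_right_mono) auto
    finally show ?thesis by (simp add: D'_def D_def power2_eq_square)
  qed
  have sq: "a \<le> exp (L * T) * b" if "a\<^sup>2 * exp (- 2 * L * T) \<le> b\<^sup>2" "b \<ge> 0" for a b :: real
  proof -
    have e: "exp (2 * L * T) = (exp (L * T))\<^sup>2"
      by (simp add: power2_eq_square flip: exp_add)
    have "a\<^sup>2 = a\<^sup>2 * exp (- 2 * L * T) * exp (2 * L * T)" by (simp add: exp_minus)
    also have "\<dots> \<le> b\<^sup>2 * exp (2 * L * T)"
      using that by (intro mult_right_mono) auto
    also have "\<dots> = (exp (L * T) * b)\<^sup>2"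
      unfolding e by (simp add: power_mult_distrib mult.commute)
    finally show ?thesis by (rule power2_le_imp_le) (use that(2) in simp)
  qed
  have "D T * exp (- 2 * L * T) \<le> D 0 * exp (- 2 * L * 0)"
  proof (rule nonincreasing_within[OF \<open>T \<ge> 0\<close>])
    fix t assume t: "t \<in> {0..T}"
    show "((\<lambda>t. D t * exp (- 2 * L * t)) has_real_derivative
        (D' t - 2 * L * D t) * exp (- 2 * L * t)) (at t within {0..T})"
      by (rule derivative_eq_intros D[OF t] refl)+ (simp add: algebra_simps)
    show "(D' t - 2 * L * D t) * exp (- 2 * L * t) \<le> 0"
      using D'_le[OF t] by (intro mult_nonpos_nonneg) auto
  qed
  then show "norm (x T - y T) \<le> exp (L * T) * norm (x 0 - y 0)"
    by (intro sq) (auto simp: D_def)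
  have "D 0 * exp (2 * L * 0) \<le> D T * exp (2 * L * T)"
  proof (rule nondecreasing_within[OF \<open>T \<ge> 0\<close>])
    fix t assume t: "t \<in> {0..T}"
    show "((\<lambda>t. D t * exp (2 * L * t)) has_real_derivative
        (D' t + 2 * L * D t) * exp (2 * L * t)) (at t within {0..T})"
      by (rule derivative_eq_intros D[OF t] refl)+ (simp add: algebra_simps)
    show "(D' t + 2 * L * D t) * exp (2 * L * t) \<ge> 0"
      using D'_le[OF t] by (intro mult_nonneg_nonneg) auto
  qed
  then show "norm (x 0 - y 0) \<le> exp (L * T) * norm (x T - y T)"
    by (intro sq) (auto simp: D_def exp_minus field_simps)
qed

lemma solves_atLeast:
  assumes "\<And>S. S \<ge> a \<Longrightarrow> solves X {a..S} x"
  shows "solves X {a..} x"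
  unfolding solves_def
proof
  fix t :: real assume t: "t \<in> {a..}"
  have "(x has_vector_derivative X (x t)) (at t within {a..t+1})"
    using assms[of "t + 1"] t by (auto simp: solves_def)
  moreover have "at t within {a..} = at t within {a..t+1}"
    by (rule at_within_nhd[of _ "{..<t+1}"]) auto
  ultimately show "(x has_vector_derivative X (x t)) (at t within {a..})" by simp
qed

section \<open>Uniqueness, perturbation and continuation for locally Lipschitz fields\<close>

locale locally_lipschitz_field =
  fixes X :: "'a::euclidean_space \<Rightarrow> 'a"
  assumes lipschitz_on_cball: "\<exists>L. L-lipschitz_on (cball 0 R) X"
begin

lemma common_bound:
  assumes "solves X {0..T} x" "solves X {0..T} y"
  obtains R where "\<And>t. t \<in> {0..T} \<Longrightarrow> x t \<in> cball 0 R \<and> y t \<in> cball 0 R"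
proof -
  have "bounded (x ` {0..T} \<union> y ` {0..T})"
    using assms[THEN solves_continuous_on]
    by (simp add: compact_continuous_image compact_imp_bounded)
  then obtain R where "\<forall>v \<in> x ` {0..T} \<union> y ` {0..T}. norm v \<le> R" unfolding bounded_iff by auto
  then show ?thesis by (intro that[of R]) auto
qed

lemma solution_unique:
  assumes "solves X {0..T} x" "solves X {0..T} y" "x 0 = y 0" "t \<in> {0..T}"
  shows "x t = y t"
proof -
  obtain R where R: "\<And>t. t \<in> {0..T} \<Longrightarrow> x t \<in> cball 0 R \<and> y t \<in> cball 0 R"
    using common_bound[OF assms(1,2)] by blast
  obtain L where L: "L-lipschitz_on (cball 0 R) X" using lipschitz_on_cball by blast
  have "{0..t} \<subseteq> {0..T}" using assms(4) by auto
  then have "norm (x t - y t) \<le> exp (L * t) * norm (x 0 - y 0)"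
    using assms(4) R by (intro gronwall_two_sided(1)[OF _ _ L] solves_subset[OF assms(1)] solves_subset[OF assms(2)]) auto
  with assms(3) show ?thesis by simp
qed

lemma solution_unique_backward:
  assumes "solves X {0..T} x" "solves X {0..T} y" "x T = y T" "T \<ge> 0"
  shows "x 0 = y 0"
proof -
  obtain R where R: "\<And>t. t \<in> {0..T} \<Longrightarrow> x t \<in> cball 0 R \<and> y t \<in> cball 0 R"
    using common_bound[OF assms(1,2)] by blast
  obtain L where L: "L-lipschitz_on (cball 0 R) X" using lipschitz_on_cball by blast
  have "norm (x 0 - y 0) \<le> exp (L * T) * norm (x T - y T)"
    by (rule gronwall_two_sided(2)[OF assms(1,2) L R \<open>T \<ge> 0\<close>])
  with assms(3) show ?thesis by simp
qed

text \<open>The nearest-point projection onto a ball is 1-Lipschitz, so this field is globally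
  Lipschitz and \<open>picard_global\<close> applies to it; its solutions solve the original
  equation as long as they stay in the ball.\<close>

definition truncated :: "real \<Rightarrow> 'a \<Rightarrow> 'a" where
  "truncated R v = X (closest_point (cball 0 R) v)"

lemma truncated_lipschitz:
  assumes "R \<ge> 0"
  obtains L where "L-lipschitz_on UNIV (truncated R)"
proof -
  obtain L where L: "L-lipschitz_on (cball 0 R) X" using lipschitz_on_cball by blast
  have ne: "cball (0::'a) R \<noteq> {}" using assms by auto
  have "L-lipschitz_on UNIV (truncated R)"
  proof (rule lipschitz_onI)
    fix u v
    have "dist (truncated R u) (truncated R v)
        \<le> L * dist (closest_point (cball 0 R) u) (closest_point (cball 0 R) v)"
      unfolding truncated_def using ne by (intro lipschitz_onD[OF L] closest_point_in_set) auto
    also have "\<dots> \<le> L * dist u v"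
      using lipschitz_on_nonneg[OF L] ne by (intro mult_left_mono closest_point_lipschitz) auto
    finally show "dist (truncated R u) (truncated R v) \<le> L * dist u v" .
  qed (use lipschitz_on_nonneg[OF L] in simp)
  then show ?thesis by (rule that)
qed

lemma solves_truncated_iff:
  assumes "\<And>t. t \<in> I \<Longrightarrow> norm (x t) \<le> R"
  shows "solves (truncated R) I x \<longleftrightarrow> solves X I x"
  using assms by (auto simp: solves_def truncated_def closest_point_self)

text \<open>Continuous dependence and continuation past \<open>S\<close> come from one construction:
  the truncated equation has a global solution, and it is a genuine one while it stays in a ball
  with room to spare.\<close>

lemma solution_perturb_extend:
  assumes x: "solves X {0..S} x" and "S \<ge> 0" "e > 0"
  obtains d where "d > 0"
    "\<And>y0. norm (y0 - x 0) < d \<Longrightarrow>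
      \<exists>S'>S. \<exists>y. y 0 = y0 \<and> solves X {0..S'} y \<and> (\<forall>t\<in>{0..S}. norm (y t - x t) < e)"
proof -
  obtain R0 where R0: "\<And>t. t \<in> {0..S} \<Longrightarrow> norm (x t) \<le> R0"
    using common_bound[OF x x] by force
  \<comment> \<open>\<open>e\<close> is the room for the perturbation on \<open>{0..S}\<close>, and
    1 is the room for the short continuation past \<open>S\<close>.\<close>
  define R where "R = R0 + e + 1"
  have "R0 \<ge> 0" using R0[of 0] \<open>S \<ge> 0\<close> norm_ge_zero[of "x 0"]
    by (meson atLeastAtMost_iff order_refl order_trans)
  then obtain L where L: "L-lipschitz_on UNIV (truncated R)"
    using truncated_lipschitz[of R] \<open>e > 0\<close> by (auto simp: R_def)
  have xR: "solves (truncated R) {0..S} x"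
    using R0 x \<open>e > 0\<close> by (subst solves_truncated_iff) (force simp: R_def)+
  define d where "d = e * exp (- L * S)"
  show ?thesis
  proof (rule that[of d])
    show "d > 0" using \<open>e > 0\<close> by (simp add: d_def)
    fix y0 assume y0: "norm (y0 - x 0) < d"
    obtain z where z: "z 0 = y0" "solves (truncated R) {0..} z"
      using picard_global[OF L] .
    have near: "norm (z t - x t) < e" if t: "t \<in> {0..S}" for t
    proof -
      have "norm (z t - x t) \<le> exp (L * t) * norm (z 0 - x 0)"
        using t by (intro gronwall_two_sided(1)[OF _ _ L] solves_subset[OF z(2)] solves_subset[OF xR]) auto
      also have "\<dots> \<le> exp (L * S) * norm (z 0 - x 0)"
        using t lipschitz_on_nonneg[OF L] by (intro mult_right_mono) (auto intro: mult_left_mono)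
      also have "\<dots> < exp (L * S) * d" using y0 z(1) by simp
      also have "\<dots> = e" by (simp add: d_def exp_minus)
      finally show ?thesis .
    qed
    have small: "norm (z t) < R0 + e" if t: "t \<in> {0..S}" for t
      using near[OF t] R0[OF t] norm_triangle_ineq[of "z t - x t" "x t"] by simp
    have "continuous_on {0..} z" using z(2) by (rule solves_continuous_on)
    then obtain \<delta> where \<delta>: "\<delta> > 0" "\<And>t. t \<ge> 0 \<Longrightarrow> dist t S < \<delta> \<Longrightarrow> dist (z t) (z S) < 1"
      using \<open>S \<ge> 0\<close> unfolding continuous_on_iff by (metis atLeast_iff zero_less_one)
    have "norm (z t) \<le> R" if t: "t \<in> {0..S + \<delta>/2}" for t
    proof (cases "t \<le> S")
      case True
      then show ?thesis using small[of t] t by (simp add: R_def)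
    next
      case False
      then have "dist (z t) (z S) < 1" using \<delta> t by (auto simp: dist_real_def)
      then show ?thesis
        using small[of S] \<open>S \<ge> 0\<close> norm_triangle_ineq[of "z t - z S" "z S"] by (simp add: R_def dist_norm)
    qed
    then have "solves X {0..S + \<delta>/2} z"
      using solves_subset[OF z(2), of "{0..S + \<delta>/2}"]
        solves_truncated_iff[of "{0..S + \<delta>/2}" z R] by auto
    then show "\<exists>S'>S. \<exists>y. y 0 = y0 \<and> solves X {0..S'} y \<and> (\<forall>t\<in>{0..S}. norm (y t - x t) < e)"
      using \<delta>(1) z(1) near by (intro exI[of _ "S + \<delta>/2"]) auto
  qed
qed

text \<open>A priori bounds exclude blow-up: while the truncated solution has norm at most
  \<open>R\<close> it solves the original equation, and then the bound says that its norm is at most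
  \<open>R - 1\<close>. The bound may depend on the horizon \<open>S\<close>.\<close>

lemma global_solution:
  assumes bound: "\<And>S. S \<ge> 0 \<Longrightarrow>
    \<exists>R. \<forall>T\<in>{0..S}. \<forall>y. y 0 = x0 \<longrightarrow> solves X {0..T} y \<longrightarrow> norm (y T) \<le> R"
  obtains x where "x 0 = x0" "solves X {0..} x"
proof -
  have "\<exists>z. z 0 = x0 \<and> solves X {0..S} z" if S: "S \<ge> 0" for S
  proof -
    obtain R0 where R0: "\<And>T y. T \<in> {0..S} \<Longrightarrow> y 0 = x0 \<Longrightarrow> solves X {0..T} y \<Longrightarrow> norm (y T) \<le> R0"
      using bound[OF S] by blast
    define R where "R = max R0 (norm x0) + 1"
    have "R \<ge> 0" unfolding R_def using norm_ge_zero[of x0] by linarith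
    then obtain L where L: "L-lipschitz_on UNIV (truncated R)" using truncated_lipschitz by blast
    obtain z where z: "z 0 = x0" "solves (truncated R) {0..} z" using picard_global[OF L] .
    have solz: "solves X {0..t} z" if "\<And>s. s \<in> {0..t} \<Longrightarrow> norm (z s) \<le> R" for t
      using solves_subset[OF z(2), of "{0..t}"] solves_truncated_iff[of "{0..t}" z R] that by auto
    have "0 < R - norm (z t)" if t: "t \<in> {0..S}" for t
    proof (rule continuous_induction_pos[OF _ _ _ t])
      show "continuous_on {0..S} (\<lambda>t. R - norm (z t))"
        by (intro continuous_intros continuous_on_subset[OF solves_continuous_on[OF z(2)]]) auto
      show "0 < R - norm (z 0)" by (simp add: z R_def)
      fix t assume "t \<in> {0..S}" and "\<And>s. s \<in> {0..t} \<Longrightarrow> 0 \<le> R - norm (z s)"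
      then have "solves X {0..t} z" by (intro solz) simp
      then have "norm (z t) \<le> R0" using \<open>t \<in> {0..S}\<close> z(1) by (intro R0)
      then show "0 < R - norm (z t)" by (simp add: R_def)
    qed
    then have "solves X {0..S} z" by (intro solz) (simp add: less_imp_le)
    then show ?thesis using z(1) by blast
  qed
  then have "\<forall>S. \<exists>z. S \<ge> 0 \<longrightarrow> z 0 = x0 \<and> solves X {0..S} z" by blast
  from choice[OF this] obtain z
    where z0: "\<forall>S. S \<ge> 0 \<longrightarrow> z S 0 = x0 \<and> solves X {0..S} (z S)" ..
  have z: "z S 0 = x0" "solves X {0..S} (z S)" if "S \<ge> 0" for S using z0 that by auto
  \<comment> \<open>Diagonal gluing; the solutions for different horizons agree by
    uniqueness.\<close>
  define x where "x t = z t t" for t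
  have "solves X {0..S} x" if S: "S \<ge> 0" for S
  proof (rule solves_cong[OF z(2)[OF S]])
    fix t assume t: "t \<in> {0..S}"
    show "x t = z S t" unfolding x_def
    proof (rule solution_unique[of t "z t" "z S"])
      show "solves X {0..t} (z t)" using t by (intro z(2)) auto
      show "solves X {0..t} (z S)" using t by (intro solves_subset[OF z(2)[OF S]]) auto
    qed (use t z(1)[of t] z(1)[of S] in auto)
  qed
  then show ?thesis using z(1)[of 0] by (intro that[of x] solves_atLeast) (auto simp: x_def)
qed

end

section \<open>The flow of the third-order equation\<close>

lemma abs_le_norm_triple:
  fixes p q r :: real
  shows "\<bar>p\<bar> \<le> norm (p, q, r) \<and> \<bar>q\<bar> \<le> norm (p, q, r) \<and> \<bar>r\<bar> \<le> norm (p, q, r)"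
  by (simp_all add: norm_Pair real_le_rsqrt)

locale similarity_flow =
  fixes b c :: real
  assumes b_c: "b + 3 = 2 * c" and c_gt: "c > 3"
begin

lemma params: "c > 0" "b > 3" "c < b" "b < 2 * c"
  using b_c c_gt by auto

text \<open>Derivatives within \<open>I\<close> are one-sided at end points, so one predicate serves
  for compact pieces of orbits and for the half-line.\<close>

definition flow :: "real set \<Rightarrow> (real \<Rightarrow> real) \<Rightarrow> (real \<Rightarrow> real) \<Rightarrow> (real \<Rightarrow> real) \<Rightarrow> bool" where
  "flow I f g h \<longleftrightarrow> (\<forall>t\<in>I. (f has_real_derivative g t) (at t within I)
     \<and> (g has_real_derivative h t) (at t within I)
     \<and> (h has_real_derivative b * (g t)\<^sup>2 - c * f t * h t) (at t within I))"

lemma flowD: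
  assumes "flow I f g h" "t \<in> I"
  shows "(f has_real_derivative g t) (at t within I)"
    and "(g has_real_derivative h t) (at t within I)"
    and "(h has_real_derivative b * (g t)\<^sup>2 - c * f t * h t) (at t within I)"
  using assms by (auto simp: flow_def)

lemma flow_subset: "flow I f g h \<Longrightarrow> J \<subseteq> I \<Longrightarrow> flow J f g h"
  unfolding flow_def by (meson DERIV_subset subsetD)

lemma flow_continuous_on:
  assumes "flow I f g h"
  shows "continuous_on I f" "continuous_on I g" "continuous_on I h"
  by (rule DERIV_continuous_on, erule flowD[OF assms])+

definition field :: "real \<times> real \<times> real \<Rightarrow> real \<times> real \<times> real" where
  "field v = (fst (snd v), snd (snd v), b * (fst (snd v))\<^sup>2 - c * fst v * snd (snd v))"

lemma solves_field_iff:
  "solves field I x \<longleftrightarrow> flow I (\<lambda>t. fst (x t)) (\<lambda>t. fst (snd (x t))) (\<lambda>t. snd (snd (x t)))"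
proof -
  have "(x has_vector_derivative (u, v, w)) F \<longleftrightarrow>
      ((\<lambda>t. fst (x t)) has_vector_derivative u) F
    \<and> ((\<lambda>t. fst (snd (x t))) has_vector_derivative v) F
    \<and> ((\<lambda>t. snd (snd (x t))) has_vector_derivative w) F" (is "?l \<longleftrightarrow> ?r") if "F = at t within I" for u v w F t
  proof
    assume l: ?l
    have 1: "((\<lambda>t. fst (x t)) has_vector_derivative u) F"
      using bounded_linear.has_vector_derivative[OF bounded_linear_fst l] by simp
    have 2: "((\<lambda>t. snd (x t)) has_vector_derivative (v, w)) F"
      using bounded_linear.has_vector_derivative[OF bounded_linear_snd l] by simp
    show ?r
      using 1 bounded_linear.has_vector_derivative[OF bounded_linear_fst 2]
        bounded_linear.has_vector_derivative[OF bounded_linear_snd 2] by simp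
  next
    assume r: ?r
    then have "((\<lambda>t. (fst (x t), fst (snd (x t)), snd (snd (x t)))) has_vector_derivative (u, v, w)) F"
      unfolding that by (intro has_vector_derivative_Pair) auto
    then show ?l by simp
  qed
  then show ?thesis
    by (simp add: solves_def flow_def field_def has_real_derivative_iff_has_vector_derivative)
qed

sublocale locally_lipschitz_field field
proof
  fix R :: real
  define L where "L = 2 + 2 * b * \<bar>R\<bar> + 2 * c * \<bar>R\<bar>"
  have "L-lipschitz_on (cball 0 R) field"
  proof (rule lipschitz_onI)
    show "L \<ge> 0" using params by (simp add: L_def)
    fix u v :: "real \<times> real \<times> real" assume uv: "u \<in> cball 0 R" "v \<in> cball 0 R"
    obtain f g h f' g' h' where e: "u = (f, g, h)" "v = (f', g', h')" by (metis prod_cases3)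
    define N where "N = norm (u - v)"
    have "N \<ge> 0" by (simp add: N_def)
    have d: "\<bar>f - f'\<bar> \<le> N" "\<bar>g - g'\<bar> \<le> N" "\<bar>h - h'\<bar> \<le> N"
      using abs_le_norm_triple[of "f - f'" "g - g'" "h - h'"] by (auto simp: e N_def)
    have R: "\<bar>f\<bar> \<le> \<bar>R\<bar>" "\<bar>g\<bar> \<le> \<bar>R\<bar>" "\<bar>h\<bar> \<le> \<bar>R\<bar>" "\<bar>f'\<bar> \<le> \<bar>R\<bar>" "\<bar>g'\<bar> \<le> \<bar>R\<bar>" "\<bar>h'\<bar> \<le> \<bar>R\<bar>"
      using abs_le_norm_triple[of f g h] abs_le_norm_triple[of f' g' h'] uv by (auto simp: e)
    have "\<bar>g\<^sup>2 - g'\<^sup>2\<bar> = \<bar>g + g'\<bar> * \<bar>g - g'\<bar>"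
      by (simp add: power2_eq_square algebra_simps flip: abs_mult)
    also have "\<dots> \<le> (2 * \<bar>R\<bar>) * N"
    proof (intro mult_mono d)
      show "\<bar>g + g'\<bar> \<le> 2 * \<bar>R\<bar>" using R abs_triangle_ineq[of g g'] by linarith
    qed auto
    finally have 1: "\<bar>b * (g\<^sup>2 - g'\<^sup>2)\<bar> \<le> b * ((2 * \<bar>R\<bar>) * N)"
      using params by (simp add: abs_mult)
    have "\<bar>f * h - f' * h'\<bar> = \<bar>f * (h - h') + (f - f') * h'\<bar>" by (simp add: algebra_simps)
    also have "\<dots> \<le> \<bar>f\<bar> * \<bar>h - h'\<bar> + \<bar>f - f'\<bar> * \<bar>h'\<bar>" by (metis abs_mult abs_triangle_ineq)
    also have "\<dots> \<le> \<bar>R\<bar> * N + N * \<bar>R\<bar>" by (intro add_mono mult_mono d R abs_ge_zero \<open>N \<ge> 0\<close>)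
    finally have 2: "\<bar>c * (f * h - f' * h')\<bar> \<le> c * (2 * \<bar>R\<bar> * N)"
      using params by (simp add: abs_mult mult_ac)
    have "dist (field u) (field v) = norm (g - g', h - h', b * (g\<^sup>2 - g'\<^sup>2) - c * (f * h - f' * h'))"
      by (simp add: field_def e dist_norm algebra_simps)
    also have "\<dots> \<le> \<bar>g - g'\<bar> + (\<bar>h - h'\<bar> + \<bar>b * (g\<^sup>2 - g'\<^sup>2) - c * (f * h - f' * h')\<bar>)"
      by (intro order_trans[OF norm_Pair_le] add_left_mono) (auto intro: order_trans[OF norm_Pair_le])
    also have "\<dots> \<le> N + (N + (b * ((2 * \<bar>R\<bar>) * N) + c * (2 * \<bar>R\<bar> * N)))"
      by (intro add_mono d order_trans[OF abs_triangle_ineq4] 1 2)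
    also have "\<dots> = L * dist u v" by (simp add: L_def N_def dist_norm algebra_simps)
    finally show "dist (field u) (field v) \<le> L * dist u v" .
  qed
  then show "\<exists>L. L-lipschitz_on (cball 0 R) field" by blast
qed

lemma flow_iff_solves: "flow I f g h \<longleftrightarrow> solves field I (\<lambda>t. (f t, g t, h t))"
  by (simp add: solves_field_iff)

lemma flow_unique:
  assumes "flow {0..T} f g h" "flow {0..T} f' g' h'" "f 0 = f' 0" "g 0 = g' 0" "h 0 = h' 0" "t \<in> {0..T}"
  shows "f t = f' t" "g t = g' t" "h t = h' t"
  using solution_unique[OF assms(1,2)[unfolded flow_iff_solves] _ assms(6)] assms by auto

text \<open>Every state with \<open>g = h = 0\<close> is a rest point, and backward uniqueness
  forbids reaching one in finite time. Hence \<open>g\<close> and \<open>h\<close> never vanish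
  together on an orbit that starts with \<open>h 0 = - 1\<close>.\<close>

lemma no_rest_point:
  assumes "flow {0..T} f g h" "T \<ge> 0" "g T = 0" "h T = 0"
  shows "h 0 = 0"
proof -
  have "flow {0..T} (\<lambda>t. f T) (\<lambda>t. 0) (\<lambda>t. 0)" by (simp add: flow_def)
  from solution_unique_backward[OF assms(1)[unfolded flow_iff_solves] this[unfolded flow_iff_solves]]
  show ?thesis using assms by simp
qed

lemma flow_perturb_extend:
  assumes "flow {0..S} f g h" "S \<ge> 0" "e > 0"
  obtains d where "d > 0"
    "\<And>a. \<bar>a - g 0\<bar> < d \<Longrightarrow> \<exists>S'>S. \<exists>f' g' h'. f' 0 = f 0 \<and> g' 0 = a \<and> h' 0 = h 0
       \<and> flow {0..S'} f' g' h'
       \<and> (\<forall>t\<in>{0..S}. \<bar>f' t - f t\<bar> < e \<and> \<bar>g' t - g t\<bar> < e \<and> \<bar>h' t - h t\<bar> < e)"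
proof -
  obtain d where d: "d > 0"
    "\<And>y0. norm (y0 - (f 0, g 0, h 0)) < d \<Longrightarrow>
      \<exists>S'>S. \<exists>y. y 0 = y0 \<and> solves field {0..S'} y \<and> (\<forall>t\<in>{0..S}. norm (y t - (f t, g t, h t)) < e)"
    using solution_perturb_extend[OF assms(1)[unfolded flow_iff_solves] assms(2,3)] by metis
  show ?thesis
  proof (rule that[OF d(1)])
    fix a assume "\<bar>a - g 0\<bar> < d"
    then have "norm ((f 0, a, h 0) - (f 0, g 0, h 0)) < d" by (simp add: norm_Pair)
    from d(2)[OF this] obtain S' y where y: "S' > S" "y 0 = (f 0, a, h 0)" "solves field {0..S'} y"
      "\<And>t. t \<in> {0..S} \<Longrightarrow> norm (y t - (f t, g t, h t)) < e" by metis
    have "\<bar>fst (y t) - f t\<bar> < e \<and> \<bar>fst (snd (y t)) - g t\<bar> < e \<and> \<bar>snd (snd (y t)) - h t\<bar> < e"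
      if "t \<in> {0..S}" for t
    proof -
      obtain p q r where pqr: "y t = (p, q, r)" by (metis prod_cases3)
      show ?thesis
        using y(4)[OF that] abs_le_norm_triple[of "p - f t" "q - g t" "r - h t"] by (auto simp: pqr)
    qed
    then show "\<exists>S'>S. \<exists>f' g' h'. f' 0 = f 0 \<and> g' 0 = a \<and> h' 0 = h 0
       \<and> flow {0..S'} f' g' h'
       \<and> (\<forall>t\<in>{0..S}. \<bar>f' t - f t\<bar> < e \<and> \<bar>g' t - g t\<bar> < e \<and> \<bar>h' t - h t\<bar> < e)"
      using y(1,2) y(3)[unfolded solves_field_iff]
      by (intro exI[of _ S'] conjI exI[of _ "\<lambda>t. fst (y t)"] exI[of _ "\<lambda>t. fst (snd (y t))"]
          exI[of _ "\<lambda>t. snd (snd (y t))"]) auto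
  qed
qed

lemma flow_global:
  assumes bound: "\<And>S. S \<ge> 0 \<Longrightarrow> \<exists>R. \<forall>T\<in>{0..S}. \<forall>f g h. f 0 = f0 \<longrightarrow> g 0 = g0 \<longrightarrow> h 0 = h0 \<longrightarrow>
     flow {0..T} f g h \<longrightarrow> \<bar>f T\<bar> \<le> R \<and> \<bar>g T\<bar> \<le> R \<and> \<bar>h T\<bar> \<le> R"
  obtains f g h where "f 0 = f0" "g 0 = g0" "h 0 = h0" "flow {0..} f g h"
proof -
  obtain x where "x 0 = (f0, g0, h0)" "solves field {0..} x"
  proof (rule global_solution[of "(f0, g0, h0)"])
    fix S :: real assume "S \<ge> 0"
    then obtain R where R: "\<And>T f g h. T \<in> {0..S} \<Longrightarrow> f 0 = f0 \<Longrightarrow> g 0 = g0 \<Longrightarrow> h 0 = h0 \<Longrightarrow>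
     flow {0..T} f g h \<Longrightarrow> \<bar>f T\<bar> \<le> R \<and> \<bar>g T\<bar> \<le> R \<and> \<bar>h T\<bar> \<le> R" using bound by metis
    have "norm (y T) \<le> R + (R + R)" if "T \<in> {0..S}" "y 0 = (f0, g0, h0)" "solves field {0..T} y" for T y
    proof -
      obtain p q r where pqr: "y T = (p, q, r)" by (metis prod_cases3)
      have "\<bar>p\<bar> \<le> R \<and> \<bar>q\<bar> \<le> R \<and> \<bar>r\<bar> \<le> R"
        using R[OF that(1) _ _ _ that(3)[unfolded solves_field_iff]] that(2) pqr by simp
      moreover have "norm (y T) \<le> \<bar>p\<bar> + (\<bar>q\<bar> + \<bar>r\<bar>)"
        unfolding pqr using norm_Pair_le[of p "(q, r)"] norm_Pair_le[of q r] by simp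
      ultimately show ?thesis by simp
    qed
    then show "\<exists>R. \<forall>T\<in>{0..S}. \<forall>y. y 0 = (f0, g0, h0) \<longrightarrow> solves field {0..T} y \<longrightarrow> norm (y T) \<le> R"
      by blast
  qed
  then show ?thesis
    by (intro that[of "\<lambda>t. fst (x t)" "\<lambda>t. fst (snd (x t))" "\<lambda>t. snd (snd (x t))"])
       (auto simp: solves_field_iff)
qed

section \<open>The trap after the inflection point\<close>

text \<open>For \<open>k = - h / g\<close> the defect is \<open>g\<^sup>2 k'\<close>.\<close>

definition defect :: "real \<Rightarrow> real \<Rightarrow> real \<Rightarrow> real" where
  "defect f g h = h\<^sup>2 + c * f * g * h - b * g ^ 3"

text \<open>\<open>- defect\<close> solves a linear equation whose source term
  \<open>(b - c) * (g t)\<^sup>2 * h t\<close> is nonnegative in the convex phase. This is where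
  \<open>b > c\<close> makes the region of negative defect invariant.\<close>

lemma defect_derivative:
  assumes "flow I f g h" "t \<in> I"
  shows "((\<lambda>t. - defect (f t) (g t) (h t)) has_real_derivative
    (b - c) * (g t)\<^sup>2 * h t - c * f t * (- defect (f t) (g t) (h t))) (at t within I)"
  unfolding defect_def
  by (rule derivative_eq_intros flowD[OF assms] refl)+
     (simp add: power2_eq_square power3_eq_cube algebra_simps)

text \<open>At \<open>g = 0\<close> the defect would be \<open>h\<^sup>2\<close>. For
  \<open>g < 0\<close> it is a quadratic in \<open>h\<close> taking a negative value; the bound on
  \<open>- g\<close> says that its discriminant is nonnegative.\<close>

lemma defect_nonpos_bounds:
  assumes E: "defect f g h < 0" and "h > 0"
  shows "g \<noteq> 0" and "g < 0 \<Longrightarrow> f > 0 \<and> h \<le> c * f * (- g) \<and> 4 * b * (- g) \<le> c\<^sup>2 * f\<^sup>2"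
proof -
  show "g \<noteq> 0"
    using E by (auto simp: defect_def power2_eq_square not_less)
  assume g: "g < 0"
  define G where "G = - g"
  have "G > 0" using g by (simp add: G_def)
  have E': "h * h + b * G ^ 3 < c * f * G * h"
    using E by (simp add: defect_def G_def power2_eq_square power3_eq_cube)
  have "b * G ^ 3 > 0" using params \<open>G > 0\<close> by simp
  then have lt: "h * h < c * f * G * h" using E' by linarith
  then have h: "h < c * f * G" using \<open>h > 0\<close> by simp
  then have "c * f * G > 0" using \<open>h > 0\<close> by simp
  then have "f > 0" using params \<open>G > 0\<close> by (simp add: zero_less_mult_iff)
  have "0 \<le> (h - c * f * G / 2)\<^sup>2" by simp
  also have "\<dots> = h * h - c * f * G * h + c\<^sup>2 * f\<^sup>2 * G\<^sup>2 / 4"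
    by (simp add: power2_eq_square algebra_simps)
  finally have "4 * (b * G ^ 3) \<le> c\<^sup>2 * f\<^sup>2 * G\<^sup>2" using E' by linarith
  then have "(4 * b * G) * G\<^sup>2 \<le> (c\<^sup>2 * f\<^sup>2) * G\<^sup>2"
    by (simp add: power2_eq_square power3_eq_cube mult_ac)
  then have "4 * b * G \<le> c\<^sup>2 * f\<^sup>2" using \<open>G > 0\<close> by simp
  then show "f > 0 \<and> h \<le> c * f * (- g) \<and> 4 * b * (- g) \<le> c\<^sup>2 * f\<^sup>2"
    using h \<open>f > 0\<close> by (simp add: G_def)
qed

text \<open>The defect is negative immediately after \<open>s\<close> and remains so; then
  \<open>g\<close> cannot pass through 0, and the bounds hold pointwise. The point \<open>s\<close>
  itself is left out because the defect may vanish there.\<close>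

lemma convex_phase_trapped:
  assumes flow: "flow {s..S} f g h" and E: "defect (f s) (g s) (h s) \<le> 0" and g: "g s < 0"
    and h: "\<And>t. t \<in> {s..S} \<Longrightarrow> h t > 0" and t: "t \<in> {s<..S}"
  shows "g t < 0 \<and> f t > 0 \<and> h t \<le> c * f t * (- g t) \<and> 4 * b * (- g t) \<le> c\<^sup>2 * (f t)\<^sup>2"
proof -
  have neg: "defect (f u) (g u) (h u) < 0" if u: "u \<in> {s<..S}" for u
  proof -
    have fl: "flow {s..u} f g h" using flow_subset[OF flow] u by simp
    have "0 < - defect (f u) (g u) (h u)"
    proof (rule linear_inequality_pos[where y = "\<lambda>t. - defect (f t) (g t) (h t)" and a = s and b = u and k = "\<lambda>t. c * f t" and r = "\<lambda>t. (b - c) * (g t)\<^sup>2 * h t"])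
      show "continuous_on {s..u} (\<lambda>t. c * f t)"
        by (intro continuous_intros flow_continuous_on(1)[OF fl])
      show "0 \<le> (b - c) * (g t)\<^sup>2 * h t" if "t \<in> {s..u}" for t
        using h[of t] u that params by auto
      show "0 < - defect (f s) (g s) (h s) \<or>
          - defect (f s) (g s) (h s) = 0 \<and> 0 < (b - c) * (g s)\<^sup>2 * h s \<and> s < u"
        using E g h[of s] u params by auto
    qed (use u defect_derivative[OF fl] in auto)
    then show ?thesis by simp
  qed
  have nz: "g u \<noteq> 0" if "u \<in> {s..t}" for u
    using neg[of u] defect_nonpos_bounds(1)[OF _ h[of u]] that t g by (cases "u = s") auto
  have "g t < 0"
    by (rule same_sign_within[OF continuous_on_subset[OF flow_continuous_on(2)[OF flow], of "{s..t}"]])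
       (use t g nz in auto)
  then show ?thesis using defect_nonpos_bounds(2)[OF neg[OF t] h[of t]] t by auto
qed

text \<open>As long as the defect is nonnegative, \<open>r = f h / g\<^sup>2\<close> stays below \<open>2 b / c\<close> while
  \<open>r + slope_gain * ln f\<close> does not decrease, so \<open>f\<close> keeps at least the fraction
  \<open>exp (- 2 b / (c * slope_gain))\<close> of its initial value. The initial bound \<open>ratio_init\<close> on
  \<open>- g / f\<^sup>2\<close> allows for half of that.\<close>

definition slope_gain :: real where "slope_gain = (b - c) / (2 * c)"

text \<open>The admissible size of \<open>- g / f\<^sup>2\<close>. Two uses fix it:
  \<open>b / c * ratio_bound = (b - c) / 4\<close> is needed in \<open>ratio_growth\<close>, and
  \<open>4 * b * ratio_bound = c * (b - c) < c\<^sup>2\<close> keeps \<open>r\<close> from reaching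
  \<open>2 * b / c\<close>.\<close>

definition ratio_bound :: real where "ratio_bound = c * (b - c) / (4 * b)"

definition ratio_init :: real where
  "ratio_init = ratio_bound * (exp (- (2 * b / c / slope_gain)) / 2)\<^sup>2"

lemma slope_gain_pos: "slope_gain > 0"
  and ratio_bound_pos: "ratio_bound > 0"
  and ratio_init_pos: "ratio_init > 0"
proof -
  show *: "slope_gain > 0" "ratio_bound > 0" using params by (auto simp: slope_gain_def ratio_bound_def)
  show "ratio_init > 0" unfolding ratio_init_def using * by simp
qed

text \<open>Along an orbit with \<open>r = f * h / g\<^sup>2\<close> and
  \<open>q = - g / f\<^sup>2\<close> the right-hand side is the derivative of \<open>r\<close>
  divided by \<open>f\<close>, and \<open>E\<close> says that the defect is nonnegative. The
  threshold \<open>1 + slope_gain\<close> is the midpoint of 1 and \<open>b / c\<close>. Below it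
  \<open>b - c * r\<close> is at least \<open>(b - c) / 2\<close> and dominates the terms in
  \<open>q\<close>; above it \<open>E\<close> leaves at least
  \<open>r * (r - 1) * q\<close>.\<close>

lemma ratio_growth:
  fixes r q p :: real
  assumes "p = r * q" "r \<ge> 0" "q > 0" and E: "r * (c - p) \<le> b" and q: "q \<le> ratio_bound"
  shows "slope_gain * q \<le> b - r * (c - 2 * p + q)"
proof (cases "r \<ge> 1 + slope_gain")
  case True
  have "slope_gain * q \<le> r * (r - 1) * q"
  proof (intro mult_right_mono)
    have "1 * slope_gain \<le> r * (r - 1)" using True slope_gain_pos by (intro mult_mono) auto
    then show "slope_gain \<le> r * (r - 1)" by simp
  qed (use assms in auto)
  also have "\<dots> = r * (p - q)" by (simp add: assms(1) algebra_simps)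
  also have "\<dots> \<le> b - r * (c - p) + r * (p - q)" using E by simp
  finally show ?thesis by (simp add: algebra_simps)
next
  case False
  have 1: "(1 + slope_gain) * c = c + (b - c) / 2" "1 + 2 * slope_gain = b / c"
    using params by (auto simp: slope_gain_def field_simps)
  have "(b / c) * q \<le> (b / c) * ratio_bound"
    using q params by (intro mult_left_mono) auto
  also have "\<dots> = (b - c) / 4" using params by (simp add: ratio_bound_def)
  also have "\<dots> \<le> (b - c) / 2" using params by simp
  finally have *: "(1 + 2 * slope_gain) * q \<le> (b - c) / 2" unfolding 1(2) .
  define A B where "A = (1 + slope_gain) * q" and "B = slope_gain * q"
  have AB: "A + B \<le> (b - c) / 2"
    using * by (simp add: A_def B_def algebra_simps)
  have r: "r * c \<le> c + (b - c) / 2" "r * q \<le> A" "0 \<le> r * p"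
    using False params assms unfolding A_def 1(1)[symmetric] by (auto intro!: mult_right_mono)
  have "B + (r * c - 2 * (r * p) + r * q) \<le> b"
    using r AB by (simp add: field_simps)
  then show ?thesis by (simp add: B_def algebra_simps)
qed

text \<open>Integrating \<open>ratio_growth\<close> turns the bound on \<open>r\<close> into a bound
  on the loss of \<open>ln f\<close>. Conversely, \<open>r = 2 * b / c\<close> with nonnegative
  defect would force \<open>c\<^sup>2 \<le> 4 * b * q\<close>, impossible while \<open>f\<close> is
  large enough to keep \<open>q\<close> below \<open>ratio_bound\<close>. Each half presupposes the
  other, hence the joint continuous induction.\<close>

lemma convex_phase_initial:
  assumes flow: "flow {s..S} f g h" and init: "h s = 0" "g s < 0" "f s > 0" "- g s < ratio_init * (f s)\<^sup>2"
    and E: "\<And>t. t \<in> {s..S} \<Longrightarrow> defect (f t) (g t) (h t) \<ge> 0"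
    and h: "\<And>t. t \<in> {s<..S} \<Longrightarrow> h t > 0" and t: "t \<in> {s..S}"
  shows "f t > 0 \<and> g t < 0 \<and> f t * h t \<le> 2 * b / c * (g t)\<^sup>2 \<and> - g t \<le> ratio_bound * (f t)\<^sup>2"
proof -
  define \<epsilon> where "\<epsilon> = exp (- (2 * b / c / slope_gain))"
  define lo where "lo = f s * \<epsilon>"
  have \<epsilon>: "0 < \<epsilon>" "\<epsilon> < 1" using params slope_gain_pos by (auto simp: \<epsilon>_def)
  have lo: "0 < lo" "lo < f s" using \<epsilon> init by (auto simp: lo_def)
  have hn: "h u \<ge> 0" if "u \<in> {s..S}" for u
    using h[of u] init that by (cases "u = s") auto
  \<comment> \<open>The margins for \<open>f \<ge> lo / 2\<close> and
    \<open>r \<le> 2 * b / c\<close>, the latter cleared of denominators so that it is continuous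
    without knowing \<open>f\<close> or \<open>g\<close> to be nonzero.\<close>
  define m where "m u = min (f u - lo / 2) (2 * b / c * (g u)\<^sup>2 - f u * h u)" for u
  have facts: "f u > 0 \<and> g u < 0 \<and> - g u < ratio_bound * (f u)\<^sup>2 \<and> f u * h u \<le> 2 * b / c * (g u)\<^sup>2"
    if t: "t \<in> {s..S}" and m: "\<forall>u\<in>{s..t}. m u \<ge> 0" and u: "u \<in> {s..t}" for t u
  proof -
    have f: "f v \<ge> lo / 2" "f v * h v \<le> 2 * b / c * (g v)\<^sup>2" if "v \<in> {s..t}" for v
      using m that by (auto simp: m_def)
    have nz: "g v \<noteq> 0" if v: "v \<in> {s..t}" for v
    proof
      assume "g v = 0"
      then have "h v > 0" using init(2) v t h[of v] by (cases "v = s") auto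
      moreover have "f v > 0" using f(1)[OF v] lo by simp
      ultimately have "f v * h v > 0" by simp
      then show False using f(2)[OF v] \<open>g v = 0\<close> by simp
    qed
    have neg: "g u < 0"
      by (rule same_sign_within[OF continuous_on_subset[OF flow_continuous_on(2)[OF flow], of "{s..t}"]])
         (use u t init(2) nz in auto)
    have "g s \<le> g u"
    proof (rule nondecreasing_within[where F = g])
      have fl: "flow {s..u} f g h" using flow_subset[OF flow] u t by simp
      show "(g has_real_derivative h v) (at v within {s..u})" if "v \<in> {s..u}" for v
        using flowD(2)[OF fl that] .
    qed (use u t hn in auto)
    then have "- g u \<le> - g s" by simp
    also have "\<dots> < ratio_init * (f s)\<^sup>2" by (rule init)
    also have "\<dots> = ratio_bound * (lo / 2)\<^sup>2"
      by (simp add: ratio_init_def lo_def \<epsilon>_def power_mult_distrib power_divide)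
    also have "\<dots> \<le> ratio_bound * (f u)\<^sup>2"
      using f(1)[OF u] lo ratio_bound_pos by (intro mult_left_mono power_mono) auto
    finally show ?thesis using neg f[OF u] lo by simp
  qed
  have pos: "m v > 0" if v: "v \<in> {s..S}" for v
  proof (rule continuous_induction_pos[OF _ _ _ v])
    show "continuous_on {s..S} m"
      unfolding m_def by (intro continuous_intros flow_continuous_on[OF flow])
    show "m s > 0" using init lo params by (simp add: m_def)
  next
    fix t assume t: "t \<in> {s..S}" and "\<And>u. u \<in> {s..t} \<Longrightarrow> m u \<ge> 0"
    then have "\<forall>u\<in>{s..t}. m u \<ge> 0" by blast
    note facts = facts[OF t this]
    have fl: "flow {s..t} f g h" using flow_subset[OF flow] t by simp
    define r where "r u = f u * h u / (g u)\<^sup>2" for u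
    have r_facts: "r u \<ge> 0" "r u * (c - r u * (- g u / (f u)\<^sup>2)) \<le> b" if u: "u \<in> {s..t}" for u
    proof -
      show "r u \<ge> 0" using facts[OF u] hn[of u] u t by (simp add: r_def)
      have "b - r u * (c - r u * (- g u / (f u)\<^sup>2)) = defect (f u) (g u) (h u) / (- g u) ^ 3"
        using facts[OF u] by (simp add: r_def defect_def field_simps power2_eq_square power3_eq_cube)
      also have "\<dots> \<ge> 0" using facts[OF u] E[of u] u t by (intro divide_nonneg_nonneg) auto
      finally show "r u * (c - r u * (- g u / (f u)\<^sup>2)) \<le> b" by simp
    qed
    have "r s + slope_gain * ln (f s) \<le> r t + slope_gain * ln (f t)"
    proof (rule nondecreasing_within[where F = "\<lambda>u. r u + slope_gain * ln (f u)"])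
      fix u assume u: "u \<in> {s..t}"
      define q where "q = - g u / (f u)\<^sup>2"
      note fu = facts[OF u]
      show "((\<lambda>u. r u + slope_gain * ln (f u)) has_real_derivative
          f u * (b - r u * (c - 2 * (r u * q) + q)) - slope_gain * f u * q) (at u within {s..t})"
        unfolding r_def
        by (rule derivative_eq_intros flowD[OF fl u] refl | use fu in force)+
           (use fu in \<open>simp add: q_def field_simps power2_eq_square\<close>)
      have "q > 0" "q \<le> ratio_bound" using fu by (auto simp: q_def field_simps)
      then have "slope_gain * q \<le> b - r u * (c - 2 * (r u * q) + q)"
        using r_facts[OF u] by (intro ratio_growth) (auto simp: q_def)
      then have "f u * (slope_gain * q) \<le> f u * (b - r u * (c - 2 * (r u * q) + q))"
        using fu by (intro mult_left_mono) auto
      then show "0 \<le> f u * (b - r u * (c - 2 * (r u * q) + q)) - slope_gain * f u * q" by (simp add: mult_ac)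
    qed (use t in auto)
    have tt: "t \<in> {s..t}" using t by simp
    note ft = facts[OF tt]
    have "r s = 0" by (simp add: r_def init)
    have "r t \<le> 2 * b / c" using ft by (simp add: r_def divide_le_eq)
    then have "slope_gain * ln (f s) \<le> 2 * b / c + slope_gain * ln (f t)"
      using \<open>r s + _ \<le> _\<close> \<open>r s = 0\<close> by linarith
    then have "slope_gain * (ln (f s) - 2 * b / c / slope_gain) \<le> slope_gain * ln (f t)"
      using slope_gain_pos by (simp add: right_diff_distrib)
    then have "ln (f s) - 2 * b / c / slope_gain \<le> ln (f t)"
      using slope_gain_pos by simp
    moreover have "ln lo = ln (f s) - 2 * b / c / slope_gain"
      using \<epsilon> init by (simp add: lo_def \<epsilon>_def ln_mult)
    ultimately have "ln lo \<le> ln (f t)" by simp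
    then have "lo \<le> f t" using lo ft by (simp only: ln_le_cancel_iff)
    have "r t \<noteq> 2 * b / c"
    proof
      assume eq: "r t = 2 * b / c"
      define q where "q = - g t / (f t)\<^sup>2"
      have "2 * b / c * (c - 2 * b / c * q) \<le> b" using r_facts(2)[OF tt] by (simp add: eq q_def)
      then have "c\<^sup>2 \<le> 4 * b * q" using params by (simp add: field_simps power2_eq_square)
      also have "\<dots> < 4 * b * ratio_bound"
      proof -
        have "q < ratio_bound" unfolding q_def using ft by (subst pos_divide_less_eq) auto
        then show ?thesis using params by simp
      qed
      also have "\<dots> = c * (b - c)" using params by (simp add: ratio_bound_def)
      also have "\<dots> \<le> c\<^sup>2" using params by (simp add: power2_eq_square)
      finally show False by simp
    qed
    with \<open>r t \<le> 2 * b / c\<close> have "r t < 2 * b / c" by simp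
    then have "f t * h t < 2 * b / c * (g t)\<^sup>2" using ft by (simp add: r_def divide_less_eq)
    then show "m t > 0" using \<open>lo \<le> f t\<close> lo by (simp add: m_def)
  qed
  have "\<forall>u\<in>{s..t}. m u \<ge> 0"
    using pos t by (auto intro!: less_imp_le)
  from facts[OF t this, of t] show ?thesis using t by (simp add: less_imp_le)
qed

text \<open>The defect is positive at \<open>s\<close>, so either it is nonnegative up to
  \<open>t\<close>, or the orbit enters the trap at its first zero. The constant
  \<open>c ^ 3\<close> is a crude one covering both cases; the bounds by powers of \<open>f\<close>
  serve to exclude blow-up.\<close>

lemma convex_phase:
  assumes flow: "flow {s..S} f g h" and init: "h s = 0" "g s < 0" "f s > 0" "- g s < ratio_init * (f s)\<^sup>2"
    and t: "t \<in> {s..S}"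
  shows "(s < t \<longrightarrow> h t > 0) \<and> f t > 0 \<and> g t < 0 \<and> - g t \<le> c ^ 3 * (f t)\<^sup>2 \<and> h t \<le> c ^ 3 * f t ^ 3"
proof -
  have h: "h u > 0" if u: "u \<in> {s<..S}" for u
  proof (rule linear_inequality_pos[where y = h and a = s and b = u and k = "\<lambda>t. c * f t" and r = "\<lambda>t. b * (g t)\<^sup>2"])
    have fl: "flow {s..u} f g h" using flow_subset[OF flow] u by simp
    show "continuous_on {s..u} (\<lambda>t. c * f t)"
      by (intro continuous_intros flow_continuous_on(1)[OF fl])
    show "(h has_real_derivative b * (g t)\<^sup>2 - c * f t * h t) (at t within {s..u})" if "t \<in> {s..u}" for t
      using flowD(3)[OF fl that] .
    show "0 < h s \<or> h s = 0 \<and> 0 < b * (g s)\<^sup>2 \<and> s < u" using init u params by simp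
  qed (use u params in auto)
  have c1: "1 \<le> c" "c \<le> c ^ 3" "c\<^sup>2 \<le> c ^ 3" using c_gt by (auto intro: self_le_power power_increasing)
  have "f t > 0 \<and> g t < 0 \<and> - g t \<le> c ^ 3 * (f t)\<^sup>2 \<and> h t \<le> c ^ 3 * f t ^ 3"
  proof (cases "\<forall>u\<in>{s..t}. defect (f u) (g u) (h u) \<ge> 0")
    case True
    have fl: "flow {s..t} f g h" using flow_subset[OF flow] t by simp
    have 1: "f t > 0" "g t < 0" "f t * h t \<le> 2 * b / c * (g t)\<^sup>2" "- g t \<le> ratio_bound * (f t)\<^sup>2"
      using convex_phase_initial[OF fl init, of t] True h t by auto
    have "ratio_bound \<le> c" "2 * b / c * ratio_bound\<^sup>2 \<le> c\<^sup>2"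
    proof -
      have rb: "ratio_bound \<le> c / 4" using params by (simp add: ratio_bound_def field_simps)
      then show "ratio_bound \<le> c" using params by simp
      have "2 * b / c * ratio_bound\<^sup>2 \<le> 4 * (c / 4)\<^sup>2"
        using rb ratio_bound_pos params by (intro mult_mono power_mono) (auto simp: divide_le_eq)
      also have "\<dots> \<le> c\<^sup>2" by (simp add: power_divide)
      finally show "2 * b / c * ratio_bound\<^sup>2 \<le> c\<^sup>2" .
    qed
    have "- g t \<le> c ^ 3 * (f t)\<^sup>2"
      using 1(4) \<open>ratio_bound \<le> c\<close> c1 by (meson mult_right_mono order_trans zero_le_power2)
    moreover have "f t * h t \<le> f t * (c ^ 3 * f t ^ 3)"
    proof -
      have "(g t)\<^sup>2 = (- g t)\<^sup>2" by simp
      also have "\<dots> \<le> (ratio_bound * (f t)\<^sup>2)\<^sup>2" using 1 by (intro power_mono) auto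
      finally have "2 * b / c * (g t)\<^sup>2 \<le> 2 * b / c * (ratio_bound * (f t)\<^sup>2)\<^sup>2"
        using params by (intro mult_left_mono) auto
      also have "\<dots> = (2 * b / c * ratio_bound\<^sup>2) * f t ^ 4" by (simp add: power_mult_distrib)
      also have "\<dots> \<le> c ^ 3 * f t ^ 4"
        using \<open>2 * b / c * ratio_bound\<^sup>2 \<le> c\<^sup>2\<close> c1 by (intro mult_right_mono) auto
      finally show ?thesis using 1(3) by (simp add: mult_ac eval_nat_numeral)
    qed
    ultimately show ?thesis using 1 by simp
  next
    case False
    then obtain w where w: "w \<in> {s..t}" "defect (f w) (g w) (h w) < 0" by force
    let ?E = "\<lambda>u. defect (f u) (g u) (h u)"
    have cont: "continuous_on {s..S} ?E"
      unfolding defect_def by (intro continuous_intros flow_continuous_on[OF flow])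
    have "b * g s ^ 3 < 0" using init params by (intro mult_pos_neg) auto
    then have Es: "?E s > 0" using init by (simp add: defect_def)
    have "w \<in> {s..S}" using w t by auto
    then obtain u where u: "s < u" "u \<le> w" "?E u = 0" "\<And>r. r \<in> {s..<u} \<Longrightarrow> ?E r > 0"
      using first_zero[OF cont Es, of w] w by (metis less_imp_le)
    have "u \<noteq> w" using u(3) w by auto
    have E: "?E r \<ge> 0" if "r \<in> {s..u}" for r
      using u(3) u(4)[of r] that by (cases "r = u") (auto intro: less_imp_le)
    have ut: "s < u" "u < t" "t \<le> S" using u \<open>u \<noteq> w\<close> w t by auto
    have fl: "flow {s..u} f g h" "flow {u..S} f g h" using flow_subset[OF flow] ut by simp_all
    have "g u < 0" using convex_phase_initial[OF fl(1) init E, of u] h ut by auto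
    then have 1: "g t < 0" "f t > 0" "h t \<le> c * f t * (- g t)" "4 * b * (- g t) \<le> c\<^sup>2 * (f t)\<^sup>2"
      using convex_phase_trapped[OF fl(2) _ _ h, of t] u(3) ut by auto
    have "1 * (- g t) \<le> 4 * b * (- g t)" using 1 params by (intro mult_right_mono) auto
    then have g: "- g t \<le> c\<^sup>2 * (f t)\<^sup>2" using 1(4) by linarith
    also have "\<dots> \<le> c ^ 3 * (f t)\<^sup>2" using c1 by (intro mult_right_mono) auto
    finally have "- g t \<le> c ^ 3 * (f t)\<^sup>2" .
    moreover have "c * f t * (- g t) \<le> c * f t * (c\<^sup>2 * (f t)\<^sup>2)"
      using g 1 params by (intro mult_left_mono) auto
    ultimately show ?thesis using 1 by (simp add: power2_eq_square power3_eq_cube mult_ac)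
  qed
  then show ?thesis using h[of t] t by auto
qed

text \<open>The monotone quantity has the right derivative only while \<open>f > 0\<close> and
  \<open>- g / f\<^sup>2 \<le> 1 / 2\<close>, which makes \<open>c - 1 + 3 * (g / f\<^sup>2)\<close>
  positive for \<open>c > 3\<close>. Both conditions are bootstrapped; \<open>l \<le> 1 / 4\<close>
  is the slack.\<close>

lemma concave_phase:
  assumes flow: "flow {s..S} f g h" and init: "f s > 0" "- g s / (f s)\<^sup>2 - h s / f s ^ 3 \<le> l" "l \<le> 1 / 4"
    and h: "\<And>t. t \<in> {s..S} \<Longrightarrow> h t \<le> 0" and t: "t \<in> {s..S}"
  shows "f t > 0 \<and> - g t \<le> l * (f t)\<^sup>2"
proof -
  \<comment> \<open>While \<open>- g / f\<^sup>2 \<le> 1 / 2\<close>, the reciprocal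
    \<open>1 / f\<close> grows at rate at most 1/2, so \<open>f \<ge> 2 * \<phi>\<close>. Half of
    this barrier turns \<open>f > 0\<close> into a closed condition that improves itself.\<close>
  define \<phi> where "\<phi> u = 1 / (2 * (1 / f s + (u - s) / 2))" for u
  have \<phi>_pos: "\<phi> u > 0" if "u \<ge> s" for u
    using that init by (simp add: \<phi>_def add_pos_nonneg)
  define m where "m u = min (f u - \<phi> u) ((f u)\<^sup>2 / 2 + g u)" for u
  have facts: "f u > 0 \<and> - g u / (f u)\<^sup>2 \<le> 1 / 2"
    if "\<forall>u\<in>{s..t}. m u \<ge> 0" and u: "u \<in> {s..t}" for t u
  proof -
    have "m u \<ge> 0" using that by blast
    then have "f u - \<phi> u \<ge> 0" "(f u)\<^sup>2 / 2 + g u \<ge> 0" by (auto simp: m_def)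
    then have "f u \<ge> \<phi> u" "- g u \<le> (f u)\<^sup>2 / 2" by linarith+
    moreover from this have "f u > 0" using \<phi>_pos[of u] u by auto
    ultimately show ?thesis using neg_ratio_le_iff[of "f u" "g u" "1 / 2"] by simp
  qed
  have key: "- g t / (f t)\<^sup>2 \<le> l" if t: "t \<in> {s..S}" and m: "\<forall>u\<in>{s..t}. m u \<ge> 0" for t
  proof -
    have fl: "flow {s..t} f g h" using flow_subset[OF flow] t by simp
    define L where "L u = - g u / (f u)\<^sup>2 - h u / f u ^ 3" for u
    have "L t \<le> L s"
    proof (rule nonincreasing_within[where F = L])
      fix u assume u: "u \<in> {s..t}"
      note fu = facts[OF m u]
      show "(L has_real_derivative
          (2 - b) * (g u)\<^sup>2 / f u ^ 3 + h u / (f u)\<^sup>2 * (c - 1 + 3 * (g u / (f u)\<^sup>2))) (at u within {s..t})"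
        unfolding L_def
        by (rule derivative_eq_intros flowD[OF fl u] refl | use fu in force)+
           (use fu in \<open>simp add: field_simps eval_nat_numeral\<close>)
      have "(2 - b) * (g u)\<^sup>2 / f u ^ 3 \<le> 0"
        using params fu by (intro divide_nonpos_pos mult_nonpos_nonneg) auto
      moreover have "h u / (f u)\<^sup>2 * (c - 1 + 3 * (g u / (f u)\<^sup>2)) \<le> 0"
        using h[of u] fu c_gt u t by (intro mult_nonpos_nonneg divide_nonpos_pos) auto
      ultimately show "(2 - b) * (g u)\<^sup>2 / f u ^ 3 + h u / (f u)\<^sup>2 * (c - 1 + 3 * (g u / (f u)\<^sup>2)) \<le> 0"
        by simp
    qed (use t in auto)
    moreover have "h t / f t ^ 3 \<le> 0"
      using h[OF t] facts[OF m, of t] t by (intro divide_nonpos_pos) auto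
    ultimately show ?thesis using init(2) by (simp add: L_def)
  qed
  have pos: "m v > 0" if v: "v \<in> {s..S}" for v
  proof (rule continuous_induction_pos[OF _ _ _ v])
    have "2 * (1 / f s + (u - s) / 2) \<noteq> 0" if "u \<in> {s..S}" for u
      using \<phi>_pos[of u] that by (auto simp: \<phi>_def)
    then have "continuous_on {s..S} \<phi>" unfolding \<phi>_def by (intro continuous_intros) auto
    then show "continuous_on {s..S} m"
      unfolding m_def by (intro continuous_intros flow_continuous_on[OF flow]) auto
    have "s \<in> {s..S}" using t by auto
    have "- g s / (f s)\<^sup>2 \<le> 1 / 4"
    proof -
      have "h s / f s ^ 3 \<le> 0" using h[OF \<open>s \<in> _\<close>] init by (intro divide_nonpos_pos) auto
      then show ?thesis using init by simp
    qed
    then have "- g s \<le> 1 / 4 * (f s)\<^sup>2" using init(1) neg_ratio_le_iff by blast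
    then have "- g s < (f s)\<^sup>2 / 2" using zero_less_power[OF init(1), of 2] by linarith
    then show "m s > 0" using init by (simp add: m_def \<phi>_def)
  next
    fix t assume t: "t \<in> {s..S}" and "\<And>u. u \<in> {s..t} \<Longrightarrow> m u \<ge> 0"
    then have m: "\<forall>u\<in>{s..t}. m u \<ge> 0" by blast
    note fu = facts[OF m]
    have fl: "flow {s..t} f g h" using flow_subset[OF flow] t by simp
    have "1 / f t \<le> 1 / f s + 1 / 2 * (t - s)"
    proof (rule increment_le_within[where F = "\<lambda>u. 1 / f u"])
      fix u assume u: "u \<in> {s..t}"
      show "((\<lambda>u. 1 / f u) has_real_derivative - g u / (f u)\<^sup>2) (at u within {s..t})"
        by (rule derivative_eq_intros flowD[OF fl u] refl | use fu[OF u] in force)+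
           (use fu[OF u] in \<open>simp add: power2_eq_square\<close>)
    qed (use fu t in auto)
    moreover have ft: "f t > 0" using fu[of t] t by simp
    ultimately have "f t \<ge> 2 * \<phi> t"
    proof -
      define A where "A = 1 / f s + (t - s) / 2"
      have "1 / f t \<le> A" using \<open>1 / f t \<le> _\<close> by (simp add: A_def)
      moreover from this have "A > 0" using ft by (smt (verit) zero_less_divide_1_iff)
      ultimately have "1 / A \<le> f t" using ft by (simp add: field_simps)
      moreover have "2 * \<phi> t = 1 / A" unfolding \<phi>_def A_def[symmetric] by simp
      ultimately show ?thesis by simp
    qed
    then have "f t > \<phi> t" using \<phi>_pos[of t] t by auto
    moreover have "- g t / (f t)\<^sup>2 \<le> 1 / 4" using key[OF t m] init by simp
    then have "- g t \<le> (f t)\<^sup>2 / 4" using ft neg_ratio_le_iff[of "f t" "g t" "1/4"] by simp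
    then have "- g t < (f t)\<^sup>2 / 2" using ft zero_less_power[of "f t" 2] by linarith
    ultimately show "m t > 0" by (simp add: m_def)
  qed
  have m: "\<forall>u\<in>{s..t}. m u \<ge> 0"
    using pos t by (auto intro!: less_imp_le)
  show ?thesis using key[OF t m] facts[OF m, of t] t neg_ratio_le_iff[of "f t" "g t" l] by simp
qed

section \<open>The critical orbit\<close>

text \<open>With \<open>p = h / (f g)\<close> and \<open>q = g / f\<^sup>2\<close>, both bounded, \<open>V = ln q + (2 / b) p\<close> increases, which keeps
  \<open>q\<close> away from \<open>0\<close> and forces \<open>f \<rightarrow> 0\<close>; a combination of \<open>p\<close>, \<open>V\<close> and \<open>ln (- f)\<close> excludes this.\<close>

lemma no_concave_solution_below_zero:
  assumes flow: "flow {0..} f g h"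
    and sgn: "\<And>t. t \<ge> 0 \<Longrightarrow> g t > 0" "\<And>t. t \<ge> 0 \<Longrightarrow> h t < 0" "\<And>t. t \<ge> 0 \<Longrightarrow> f t \<le> 0"
  shows False
proof -
  have fl: "flow {s..t} f g h" if "s \<ge> 0" for s t
    using that by (intro flow_subset[OF flow]) auto
  have g_anti: "g t \<le> g s" if "0 \<le> s" "s \<le> t" for s t
    by (rule nonincreasing_within[OF \<open>s \<le> t\<close> flowD(2)[OF fl[OF \<open>0 \<le> s\<close>]]])
       (use sgn(2) that in \<open>auto intro: less_imp_le\<close>)
  have f: "f t < 0" if "t \<ge> 0" for t
  proof -
    have "f t + g (t + 1) * (t + 1 - t) \<le> f (t + 1)"
      by (rule increment_ge_within[where F = f, OF _ flowD(1)[OF fl[OF that]]]) (use g_anti that in auto)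
    then show ?thesis using sgn(1)[of "t + 1"] sgn(3)[of "t + 1"] that by simp
  qed
  \<comment> \<open>Once negative, \<open>h - b * f * g\<close> keeps decreasing because
    \<open>f * h > 0\<close>; then \<open>h\<close> stays below a negative constant and
    \<open>g\<close> must reach 0.\<close>
  have h_ge: "h s \<ge> b * f s * g s" if s: "s \<ge> 0" for s
  proof (rule ccontr)
    define M where "M t = h t - b * f t * g t" for t
    assume "\<not> ?thesis"
    then have M: "M s < 0" by (simp add: M_def)
    have M_anti: "M t \<le> M s" if "s \<le> t" for t
    proof (rule nonincreasing_within[OF that, where F = M])
      fix u assume u: "u \<in> {s..t}"
      show "(M has_real_derivative - (b + c) * (f u * h u)) (at u within {s..t})"
        unfolding M_def
        by (rule derivative_eq_intros flowD[OF fl[OF s] u] refl)+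
           (simp add: power2_eq_square algebra_simps)
      have "f u * h u > 0" using f[of u] sgn(2)[of u] u s by (intro mult_neg_neg) auto
      then show "- (b + c) * (f u * h u) \<le> 0" using params by (intro mult_nonpos_nonneg) auto
    qed
    have h_le: "h t \<le> M s" if "s \<le> t" for t
    proof -
      have "b * (f t * g t) < 0" using f[of t] sgn(1)[of t] params that s by (intro mult_pos_neg mult_neg_pos) auto
      then show ?thesis using M_anti[OF that] by (simp add: M_def)
    qed
    define t where "t = s + g s / - M s"
    have "s \<le> t" using M sgn(1)[OF s] by (simp add: t_def divide_nonneg_neg)
    have "g t \<le> g s + M s * (t - s)"
      by (rule increment_le_within[where F = g, OF \<open>s \<le> t\<close> flowD(2)[OF fl[OF s]]]) (use h_le in auto)
    also have "\<dots> = 0" using M by (simp add: t_def)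
    finally show False using sgn(1)[of t] \<open>s \<le> t\<close> s by simp
  qed
  \<comment> \<open>The same argument one order lower: \<open>h_ge\<close> makes
    \<open>g - b / 2 * f\<^sup>2\<close> nondecreasing, and a positive value would force
    \<open>f\<close> up to 0.\<close>
  have g_le: "g s \<le> b / 2 * (f s)\<^sup>2" if s: "s \<ge> 0" for s
  proof (rule ccontr)
    define M where "M t = g t - b / 2 * (f t)\<^sup>2" for t
    assume "\<not> ?thesis"
    then have M: "M s > 0" by (simp add: M_def)
    have M_mono: "M s \<le> M t" if "s \<le> t" for t
    proof (rule nondecreasing_within[OF that, where F = M])
      fix u assume u: "u \<in> {s..t}"
      show "(M has_real_derivative h u - b * f u * g u) (at u within {s..t})"
        unfolding M_def
        by (rule derivative_eq_intros flowD[OF fl[OF s] u] refl)+ simp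
      show "0 \<le> h u - b * f u * g u" using h_ge[of u] u s by simp
    qed
    have g_ge: "g t \<ge> M s" if "s \<le> t" for t
    proof -
      have "b / 2 * (f t)\<^sup>2 \<ge> 0" using params by simp
      then show ?thesis using M_mono[OF that] by (simp add: M_def)
    qed
    define t where "t = s + (- f s) / M s"
    have "s \<le> t" using M f[OF s] by (simp add: t_def divide_nonpos_pos)
    have "f s + M s * (t - s) \<le> f t"
      by (rule increment_ge_within[where F = f, OF \<open>s \<le> t\<close> flowD(1)[OF fl[OF s]]]) (use g_ge in auto)
    moreover have "f s + M s * (t - s) = 0" using M by (simp add: t_def)
    ultimately show False using f[of t] \<open>s \<le> t\<close> s by simp
  qed
  define p where "p t = h t / (f t * g t)" for t
  define q where "q t = g t / (f t)\<^sup>2" for t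
  \<comment> \<open>The factor \<open>2 / b\<close> cancels the terms in \<open>q\<close> alone,
    \<open>2 * q\<close> from \<open>ln q\<close> against \<open>b * q\<close> from
    \<open>p\<close>; with \<open>2 * c = b + 3\<close> what remains has one sign.\<close>
  define V where "V t = ln (q t) + 2 / b * p t" for t
  have pq: "0 < p t" "p t \<le> b" "0 < q t" "q t \<le> b / 2" if "t \<ge> 0" for t
  proof -
    have fg: "f t * g t < 0" using f[OF that] sgn(1)[OF that] by (intro mult_neg_pos)
    then show "0 < p t" using sgn(2)[OF that] by (simp add: p_def divide_neg_neg)
    show "p t \<le> b" unfolding p_def using h_ge[OF that] fg by (simp add: neg_divide_le_eq mult_ac)
    have "(f t)\<^sup>2 > 0" using f[OF that] by simp
    then show "0 < q t" "q t \<le> b / 2"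
      unfolding q_def using g_le[OF that] sgn(1)[OF that] by (auto simp only: pos_divide_le_eq intro: divide_pos_pos)
  qed
  have p_deriv: "(p has_real_derivative - f u * ((p u)\<^sup>2 + c * p u + p u * q u - b * q u)) (at u within {0..t})"
    and q_deriv: "(q has_real_derivative - f u * (q u * (2 * q u - p u))) (at u within {0..t})"
    and V_deriv: "(V has_real_derivative - f u * (p u * (3 + 2 * p u + 2 * q u) / b)) (at u within {0..t})"
    if u: "u \<in> {0..t}" for u t
  proof -
    note nz = f[of u] sgn(1)[of u]
    show p': "(p has_real_derivative - f u * ((p u)\<^sup>2 + c * p u + p u * q u - b * q u)) (at u within {0..t})"
      unfolding p_def q_def
      by (rule derivative_eq_intros flowD[OF fl u] refl | use nz u in force)+
         (use nz u in \<open>simp add: field_simps eval_nat_numeral\<close>)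
    show q': "(q has_real_derivative - f u * (q u * (2 * q u - p u))) (at u within {0..t})"
      unfolding p_def q_def
      by (rule derivative_eq_intros flowD[OF fl u] refl | use nz u in force)+
         (use nz u in \<open>simp add: field_simps eval_nat_numeral\<close>)
    have "q u > 0" using pq u by simp
    have "c = (b + 3) / 2" using b_c by simp
    show "(V has_real_derivative - f u * (p u * (3 + 2 * p u + 2 * q u) / b)) (at u within {0..t})"
      unfolding V_def
      by (rule derivative_eq_intros p' q' refl \<open>q u > 0\<close>)+
         (use \<open>q u > 0\<close> params in \<open>simp add: \<open>c = _\<close> field_simps power2_eq_square\<close>)
  qed
  have V_mono: "V 0 \<le> V t" if t: "t \<ge> 0" for t
  proof (rule nondecreasing_within[OF t V_deriv])
    fix u assume u: "u \<in> {0..t}"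
    then show "0 \<le> - f u * (p u * (3 + 2 * p u + 2 * q u) / b)"
      using pq[of u] f[of u] params by (intro mult_nonneg_nonneg divide_nonneg_nonneg) auto
  qed
  define q0 where "q0 = exp (V 0 - 2)"
  have "q0 > 0" by (simp add: q0_def)
  have q_ge: "q0 \<le> q t" if "t \<ge> 0" for t
  proof -
    have "2 / b * p t \<le> 2" using pq[OF that] params by (simp add: divide_le_eq)
    then have "V 0 - 2 \<le> ln (q t)" using V_mono[OF that] by (simp add: V_def)
    then show ?thesis using pq(3)[OF that] by (simp add: q0_def ln_ge_iff)
  qed
  \<comment> \<open>Chosen so that \<open>C * (3 * p / b) = p * (c + 3 * b / 2)\<close>, which
    dominates \<open>p * (c + p + q)\<close> because \<open>p + q \<le> 3 * b / 2\<close>. The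
    leftover \<open>- b * q\<close> in the derivative of \<open>p\<close> absorbs
    \<open>2 * q0 * q\<close>, since \<open>q0 \<le> b / 2\<close>.\<close>
  define C where "C = b * (c + 3 * b / 2) / 3"
  define Z where "Z t = p t - C * V t - 2 * q0 * ln (- f t)" for t
  have "C > 0" using params by (simp add: C_def add_pos_pos)
  have Z_anti: "Z t \<le> Z 0" if t: "t \<ge> 0" for t
  proof (rule nonincreasing_within[OF t, where F = Z])
    fix u assume u: "u \<in> {0..t}"
    define Z' where "Z' = (p u)\<^sup>2 + c * p u + p u * q u - b * q u - C * (p u * (3 + 2 * p u + 2 * q u) / b) + 2 * q0 * q u"
    define W where "W = p u * (3 + 2 * p u + 2 * q u) / b"
    have V': "(V has_real_derivative - f u * W) (at u within {0..t})"
      unfolding W_def using V_deriv[OF u] .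
    have "g u / f u = f u * q u" using f[of u] u by (simp add: q_def power2_eq_square)
    then have Z'_eq: "- f u * ((p u)\<^sup>2 + c * p u + p u * q u - b * q u) - C * (- f u * W) - 2 * q0 * (g u / f u)
        = - f u * Z'"
      unfolding Z'_def W_def[symmetric] by (simp add: algebra_simps)
    show "(Z has_real_derivative - f u * Z') (at u within {0..t})"
      unfolding Z_def Z'_eq[symmetric]
      by (rule derivative_eq_intros p_deriv[OF u] V' flowD[OF fl u] refl | use f[of u] u in force)+
    have pqu: "0 < p u" "p u \<le> b" "0 < q u" "q u \<le> b / 2" "q0 \<le> q u" using pq[of u] q_ge[of u] u by auto
    have "p u * (p u + q u) \<le> p u * (3 * b / 2)" using pqu by (intro mult_left_mono) auto
    moreover have "C * (p u * 3 / b) \<le> C * (p u * (3 + 2 * p u + 2 * q u) / b)"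
      using pqu params \<open>C > 0\<close> by (intro mult_left_mono divide_right_mono) auto
    moreover have "C * (p u * 3 / b) = p u * (c + 3 * b / 2)" using params by (simp add: C_def)
    moreover have "2 * q0 * q u \<le> b * q u" using pqu by (intro mult_right_mono) auto
    ultimately have "Z' \<le> 0" unfolding Z'_def by (simp add: power2_eq_square algebra_simps)
    then show "- f u * Z' \<le> 0" using f[of u] u by (simp add: mult_nonpos_nonpos mult_nonneg_nonpos)
  qed
  define \<nu> where "\<nu> = - (Z 0 + C * (ln (b / 2) + 2)) / (2 * q0)"
  have ln_ge: "\<nu> \<le> ln (- f t)" if t: "t \<ge> 0" for t
  proof -
    have "ln (q t) \<le> ln (b / 2)" using pq[OF t] params by simp
    moreover have "2 / b * p t \<le> 2" using pq[OF t] params by (simp add: divide_le_eq)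
    ultimately have "C * V t \<le> C * (ln (b / 2) + 2)" using \<open>C > 0\<close> by (intro mult_left_mono) (auto simp: V_def)
    then have "- (2 * q0 * ln (- f t)) \<le> Z 0 + C * (ln (b / 2) + 2)"
      using Z_anti[OF t] pq(1)[OF t] by (simp add: Z_def)
    then show ?thesis using \<open>q0 > 0\<close> by (simp add: \<nu>_def divide_le_eq mult_ac)
  qed
  \<comment> \<open>\<open>- 1 / f\<close> grows at rate at least \<open>q0\<close> and so exceeds
    \<open>exp (- \<nu>)\<close> at this time, the bound that \<open>ln_ge\<close> imposes on
    it.\<close>
  define t where "t = exp (- \<nu>) / q0"
  have "t \<ge> 0" using \<open>q0 > 0\<close> by (simp add: t_def)
  have "- 1 / f 0 + q0 * (t - 0) \<le> - 1 / f t"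
  proof (rule increment_ge_within[where F = "\<lambda>t. - 1 / f t", OF \<open>t \<ge> 0\<close>])
    fix u assume u: "u \<in> {0..t}"
    show "((\<lambda>t. - 1 / f t) has_real_derivative q u) (at u within {0..t})"
      by (rule derivative_eq_intros flowD[OF fl u] refl | use f[of u] u in force)+
         (use f[of u] u in \<open>simp add: q_def power2_eq_square\<close>)
    show "q0 \<le> q u" using q_ge u by simp
  qed
  moreover have "- 1 / f 0 > 0" using f[of 0] by (simp add: divide_neg_neg)
  moreover have "q0 * (t - 0) = exp (- \<nu>)" using \<open>q0 > 0\<close> by (simp add: t_def)
  ultimately have "exp (- \<nu>) < - 1 / f t" by linarith
  moreover have "exp \<nu> \<le> - f t" using ln_ge[OF \<open>t \<ge> 0\<close>] f[OF \<open>t \<ge> 0\<close>] by (simp add: ln_ge_iff)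
  then have "inverse (- f t) \<le> inverse (exp \<nu>)" by (intro le_imp_inverse_le) auto
  ultimately show False by (simp add: exp_minus divide_inverse)
qed

section \<open>Perturbed orbits and the set of descending slopes\<close>

definition nearby_flow where
  "nearby_flow S e f g h a S' f' g' h' \<longleftrightarrow> S' > S \<and> f' 0 = f 0 \<and> g' 0 = a \<and> h' 0 = h 0 \<and> flow {0..S'} f' g' h'
     \<and> (\<forall>t\<in>{0..S}. \<bar>f' t - f t\<bar> < e \<and> \<bar>g' t - g t\<bar> < e \<and> \<bar>h' t - h t\<bar> < e)"

lemma ex_nearby_flow:
  assumes "flow {0..S} f g h" "S \<ge> 0" "e > 0"
  obtains d where "d > 0" "\<And>a. \<bar>a - g 0\<bar> < d \<Longrightarrow> \<exists>S' f' g' h'. nearby_flow S e f g h a S' f' g' h'"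
  using flow_perturb_extend[OF assms] unfolding nearby_flow_def by metis

text \<open>Only a compact piece of the orbit is asked for, since an arbitrary slope need not have a
  known global orbit.\<close>

definition descending :: "real \<Rightarrow> real \<Rightarrow> real \<Rightarrow> (real \<Rightarrow> real) \<Rightarrow> (real \<Rightarrow> real) \<Rightarrow> (real \<Rightarrow> real) \<Rightarrow> bool" where
  "descending f0 a T f g h \<longleftrightarrow> T \<ge> 0 \<and> flow {0..T} f g h \<and> f 0 = f0 \<and> g 0 = a \<and> h 0 = - 1
     \<and> (\<forall>t\<in>{0..T}. h t < 0) \<and> g T < 0"

definition descent_slopes :: "real \<Rightarrow> real set" where
  "descent_slopes f0 = {a. \<exists>T f g h. descending f0 a T f g h}"

lemma negative_slope_descends:
  assumes "a < 0"
  shows "a \<in> descent_slopes f0"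
proof -
  \<comment> \<open>On a one-point interval every derivative statement holds trivially, so
    \<open>T = 0\<close> and constant functions are a witness.\<close>
  have "at (0::real) within {0..0} = bot" by (simp add: at_within_def)
  then have "flow {0..0} (\<lambda>t. f0) (\<lambda>t. a) (\<lambda>t. - 1)"
    by (simp add: flow_def has_field_derivative_def has_derivative_def bounded_linear_mult_right)
  then have "descending f0 a 0 (\<lambda>t. f0) (\<lambda>t. a) (\<lambda>t. - 1)" using assms by (simp add: descending_def)
  then show ?thesis unfolding descent_slopes_def by blast
qed

text \<open>On the compact interval \<open>{0..T}\<close> the negative \<open>h\<close> stays away
  from 0, so every condition in \<open>descending\<close> survives a small change of slope.\<close>

lemma descent_slopes_open:
  assumes "a \<in> descent_slopes f0"
  obtains d where "d > 0" "\<And>a'. \<bar>a' - a\<bar> < d \<Longrightarrow> a' \<in> descent_slopes f0"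
proof -
  obtain T f g h where D: "descending f0 a T f g h" using assms by (auto simp: descent_slopes_def)
  then have fl: "flow {0..T} f g h" and T: "T \<ge> 0" and h: "\<And>t. t \<in> {0..T} \<Longrightarrow> h t < 0" and "g T < 0"
    and init: "f 0 = f0" "g 0 = a" "h 0 = - 1"
    by (auto simp: descending_def)
  obtain e where e: "e > 0" "\<And>t. t \<in> {0..T} \<Longrightarrow> e \<le> - h t"
    using continuous_pos_lower_bound[of 0 T "\<lambda>t. - h t"] flow_continuous_on(3)[OF fl] T h
    by (auto intro: continuous_on_minus)
  define e' where "e' = min e (- g T)"
  have "e' > 0" using e \<open>g T < 0\<close> by (simp add: e'_def)
  obtain d where d: "d > 0" "\<And>a'. \<bar>a' - g 0\<bar> < d \<Longrightarrow> \<exists>S' f' g' h'. nearby_flow T e' f g h a' S' f' g' h'"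
    using ex_nearby_flow[OF fl T \<open>e' > 0\<close>] by blast
  show ?thesis
  proof (rule that[OF d(1)])
    fix a' assume "\<bar>a' - a\<bar> < d"
    then obtain S' f' g' h' where "nearby_flow T e' f g h a' S' f' g' h'" using d(2)[of a'] init by blast
    then have y: "S' > T" "f' 0 = f0" "g' 0 = a'" "h' 0 = - 1" "flow {0..S'} f' g' h'"
      and near: "\<And>t. t \<in> {0..T} \<Longrightarrow> \<bar>g' t - g t\<bar> < - g T \<and> \<bar>h' t - h t\<bar> < e"
      by (auto simp: nearby_flow_def e'_def init)
    have "descending f0 a' T f' g' h'"
      unfolding descending_def
    proof (intro conjI ballI)
      show "flow {0..T} f' g' h'" using flow_subset[OF y(5)] y(1) by simp
      show "h' t < 0" if "t \<in> {0..T}" for t using near[OF that] e(2)[OF that] by linarith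
      show "g' T < 0" using near[of T] T by force
    qed (use y T in auto)
    then show "a' \<in> descent_slopes f0" unfolding descent_slopes_def by blast
  qed
qed

text \<open>Since \<open>f \<ge> - \<bar>f 0\<bar>\<close>, the damping term can make
  \<open>- h\<close> grow at most at the rate \<open>c * \<bar>f 0\<bar>\<close>, and
  \<open>b * g\<^sup>2\<close> only helps.\<close>

lemma concave_increasing_bounds:
  assumes fl: "flow {0..T} f g h" and h0: "h 0 = - 1"
    and sgn: "\<And>t. t \<in> {0..T} \<Longrightarrow> g t \<ge> 0 \<and> h t \<le> 0" and t: "t \<in> {0..T}"
  shows "f t \<ge> f 0" "- exp (c * \<bar>f 0\<bar> * t) \<le> h t"
proof -
  have f: "f u \<ge> f 0" if u: "u \<in> {0..T}" for u
  proof (rule nondecreasing_within[where F = f])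
    have fl: "flow {0..u} f g h" using flow_subset[OF fl] u by simp
    show "(f has_real_derivative g v) (at v within {0..u})" if "v \<in> {0..u}" for v using flowD(1)[OF fl that] .
  qed (use u sgn in auto)
  show "f t \<ge> f 0" using f[OF t] .
  define k where "k = c * \<bar>f 0\<bar>"
  have fl: "flow {0..t} f g h" using flow_subset[OF fl] t by simp
  have "h 0 * exp (- k * 0) \<le> h t * exp (- k * t)"
  proof (rule nondecreasing_within[where F = "\<lambda>t. h t * exp (- k * t)"])
    fix u assume u: "u \<in> {0..t}"
    show "((\<lambda>t. h t * exp (- k * t)) has_real_derivative (b * (g u)\<^sup>2 - (c * f u + k) * h u) * exp (- k * u)) (at u within {0..t})"
      by (rule derivative_eq_intros flowD[OF fl u] refl)+ (simp add: algebra_simps)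
    have "c * f u + k \<ge> 0"
    proof -
      have "- \<bar>f 0\<bar> \<le> f u" using f[of u] u t by auto
      then have "c * (f u + \<bar>f 0\<bar>) \<ge> 0" using params by simp
      then show ?thesis by (simp add: k_def algebra_simps)
    qed
    then have *: "(c * f u + k) * h u \<le> 0" using sgn[of u] u t by (intro mult_nonneg_nonpos) auto
    then show "0 \<le> (b * (g u)\<^sup>2 - (c * f u + k) * h u) * exp (- k * u)"
    proof (intro mult_nonneg_nonneg)
      have "b * (g u)\<^sup>2 \<ge> 0" using params by simp
      with * show "0 \<le> b * (g u)\<^sup>2 - (c * f u + k) * h u" by linarith
    qed auto
  qed (use t in auto)
  then have "- 1 \<le> h t * exp (- k * t)" using h0 by simp
  then have "- 1 * exp (k * t) \<le> h t * exp (- k * t) * exp (k * t)" by (intro mult_right_mono) auto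
  also have "\<dots> = h t" by (simp add: exp_minus)
  finally show "- exp (c * \<bar>f 0\<bar> * t) \<le> h t" by (simp add: k_def)
qed

text \<open>A steep start keeps \<open>g\<close> so large on \<open>{0..1}\<close> that
  \<open>h\<close> grows there at rate at least 1 and reaches 0 by time 1, before \<open>g\<close>
  can vanish. With \<open>k = c * \<bar>f0\<bar>\<close>, the loss of \<open>g\<close> is at most
  \<open>exp k\<close> and \<open>c * f * h\<close> is at most \<open>k * exp k\<close>.\<close>

lemma descent_slopes_bounded_above:
  assumes "a \<in> descent_slopes f0"
  shows "a \<le> exp (c * \<bar>f0\<bar>) + 1 + c * \<bar>f0\<bar> * exp (c * \<bar>f0\<bar>)"
proof (rule ccontr)
  define k where "k = c * \<bar>f0\<bar>"
  have k: "k \<ge> 0" using params by (simp add: k_def)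
  assume "\<not> ?thesis"
  then have a: "a - exp k > 1 + k * exp k" by (simp add: k_def)
  have a1: "a - exp k > 1" "a > 0" using a k by (smt (verit) exp_gt_zero mult_nonneg_nonneg)+
  obtain T f g h where D: "descending f0 a T f g h" using assms by (auto simp: descent_slopes_def)
  then have fl: "flow {0..T} f g h" and T: "T \<ge> 0" and h: "\<And>t. t \<in> {0..T} \<Longrightarrow> h t < 0" and "g T < 0"
    and init: "f 0 = f0" "g 0 = a" "h 0 = - 1"
    by (auto simp: descending_def)
  obtain u where u: "0 < u" "u \<le> T" "g u = 0" "\<And>r. r \<in> {0..<u} \<Longrightarrow> g r > 0"
    using first_zero[OF flow_continuous_on(2)[OF fl], of T] init a1 T \<open>g T < 0\<close> by auto
  have flu: "flow {0..u} f g h" using flow_subset[OF fl] u by simp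
  have g: "g r \<ge> 0" if "r \<in> {0..u}" for r using u(3) u(4)[of r] that by (cases "r = u") (auto intro: less_imp_le)
  have h_ge: "- exp (k * t) \<le> h t" and f_ge: "f t \<ge> - \<bar>f0\<bar>" if "t \<in> {0..u}" for t
  proof -
    have "g r \<ge> 0 \<and> h r \<le> 0" if "r \<in> {0..u}" for r using g[OF that] h[of r] u that by auto
    from concave_increasing_bounds[OF flu init(3) this that]
    show "- exp (k * t) \<le> h t" "f t \<ge> - \<bar>f0\<bar>" by (auto simp: init k_def)
  qed
  \<comment> \<open>It is not yet known that \<open>g\<close> survives until time 1; the estimate on
    \<open>{0..v}\<close> shows \<open>v \<noteq> u\<close>.\<close>
  define v where "v = min u 1"
  have v: "0 < v" "v \<le> 1" "v \<le> u" using u by (auto simp: v_def)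
  have h_ge1: "- exp k \<le> h t" if "t \<in> {0..v}" for t
  proof -
    have "k * t \<le> k * 1" using that v k by (intro mult_left_mono) auto
    then have "exp (k * t) \<le> exp k" by simp
    moreover have "- exp (k * t) \<le> h t" using h_ge[of t] that v by simp
    ultimately show ?thesis by linarith
  qed
  have g_ge: "a - exp k \<le> g t" if t: "t \<in> {0..v}" for t
  proof -
    have flt: "flow {0..t} f g h" using flow_subset[OF flu] t v by simp
    have "g 0 + (- exp k) * (t - 0) \<le> g t"
      by (rule increment_ge_within[where F = g, OF _ flowD(2)[OF flt]]) (use h_ge1 t in auto)
    then have "a - exp k * t \<le> g t" using init by simp
    moreover have "exp k * t \<le> exp k * 1" using t v by (intro mult_left_mono) auto
    ultimately show ?thesis by linarith
  qed
  have "v \<noteq> u" using g_ge[of v] v a1 u(3) by auto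
  then have "v = 1" by (simp add: v_def min_def split: if_splits)
  have flv: "flow {0..1} f g h" using flow_subset[OF flu] v \<open>v = 1\<close> by simp
  have "h 0 + 1 * (1 - 0) \<le> h 1"
  proof (rule increment_ge_within[where F = h, OF _ flowD(3)[OF flv]])
    fix t :: real assume t: "t \<in> {0..1}"
    have "1 + k * exp k \<le> g t" using g_ge[of t] t a \<open>v = 1\<close> by simp
    moreover have "1 \<le> 1 + k * exp k" using k by simp
    ultimately have "1 \<le> g t" by linarith
    then have "1 * g t * 1 \<le> b * g t * g t" using params by (intro mult_mono) auto
    then have "1 + k * exp k \<le> b * (g t)\<^sup>2" using \<open>1 + k * exp k \<le> g t\<close> by (simp add: power2_eq_square)
    moreover have "c * f t * h t \<le> k * exp k"
    proof -
      have "(c * f t) * h t \<le> (- k) * h t"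
      proof (rule mult_right_mono_neg)
        have "c * (- \<bar>f0\<bar>) \<le> c * f t" using f_ge[of t] t v \<open>v = 1\<close> params by (intro mult_left_mono) auto
        then show "- k \<le> c * f t" by (simp add: k_def)
        show "h t \<le> 0" using h[of t] t v u \<open>v = 1\<close> by auto
      qed
      also have "\<dots> \<le> k * exp k"
        using h_ge1[of t] t \<open>v = 1\<close> mult_left_mono[of "- h t" "exp k" k] k by simp
      finally show ?thesis .
    qed
    ultimately show "1 \<le> b * (g t)\<^sup>2 - c * f t * h t" by simp
  qed auto
  then show False using init h[of 1] v u \<open>v = 1\<close> by auto
qed

lemma descent_slopes_nonempty: "descent_slopes f0 \<noteq> {}"
  using negative_slope_descends[of "-1" f0] by auto

lemma bdd_above_descent_slopes: "bdd_above (descent_slopes f0)"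
  using descent_slopes_bounded_above by (intro bdd_aboveI) auto

lemma Sup_descent_slopes_notin: "Sup (descent_slopes f0) \<notin> descent_slopes f0"
proof
  assume "Sup (descent_slopes f0) \<in> descent_slopes f0"
  then obtain d where d: "d > 0"
    "\<And>a'. \<bar>a' - Sup (descent_slopes f0)\<bar> < d \<Longrightarrow> a' \<in> descent_slopes f0"
    using descent_slopes_open by blast
  then have "Sup (descent_slopes f0) + d / 2 \<in> descent_slopes f0" by simp
  from cSup_upper[OF this bdd_above_descent_slopes] d(1) show False by simp
qed

text \<open>Consider the first exit from \<open>g > 0 > h\<close>. If \<open>h\<close> is still
  negative there, a short continuation puts \<open>A\<close> into the descending set, which does not
  contain its supremum. If \<open>h\<close> vanishes, then \<open>g > 0\<close> by
  \<open>no_rest_point\<close>, so \<open>h\<close> becomes positive; this persists for nearby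
  slopes, yet some of them descend.\<close>

lemma critical_slope_flow:
  assumes sup: "A = Sup (descent_slopes f0)"
    and fl: "flow {0..S} f g h" and init: "f 0 = f0" "g 0 = A" "h 0 = - 1" and t: "t \<in> {0..S}"
  shows "g t > 0 \<and> h t < 0"
proof (rule ccontr)
  assume neg: "\<not> ?thesis"
  note ne = descent_slopes_nonempty[of f0] and bdd = bdd_above_descent_slopes[of f0]
  have notin: "A \<notin> descent_slopes f0" using Sup_descent_slopes_notin unfolding sup .
  define m where "m t = min (g t) (- h t)" for t
  have "m t \<le> 0" using neg by (auto simp: m_def)
  have "continuous_on {0..S} m" unfolding m_def by (intro continuous_intros flow_continuous_on[OF fl])
  then obtain s where s: "s \<in> {0..t}" "m s \<le> 0" "\<And>r. r \<in> {0..<s} \<Longrightarrow> m r > 0"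
    using ex_first_nonpos[of 0 S m t] t \<open>m t \<le> 0\<close> by blast
  have before: "g r > 0" "h r < 0" if "r \<in> {0..<s}" for r using s(3)[OF that] by (auto simp: m_def)
  have fls: "flow {0..s} f g h" and s0: "s \<ge> 0" using flow_subset[OF fl] s t by auto
  \<comment> \<open>Only the continuation past \<open>s\<close> is wanted, as \<open>s\<close> may
    be the end point \<open>S\<close>; the tolerance 1 is arbitrary.\<close>
  obtain d1 where "d1 > 0" "\<And>a. \<bar>a - g 0\<bar> < d1 \<Longrightarrow> \<exists>S' f' g' h'. nearby_flow s 1 f g h a S' f' g' h'"
    using ex_nearby_flow[OF fls s0, of 1] zero_less_one by blast
  then obtain S' f' g' h' where "nearby_flow s 1 f g h (g 0) S' f' g' h'" by fastforce
  then have ext: "S' > s" "f' 0 = f0" "g' 0 = A" "h' 0 = - 1" "flow {0..S'} f' g' h'"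
    by (auto simp: nearby_flow_def init)
  have flse: "flow {0..s} f' g' h'" using flow_subset[OF ext(5)] ext(1) by simp
  have eq: "f' r = f r" "g' r = g r" "h' r = h r" if "r \<in> {0..s}" for r
    using flow_unique[OF flse fls _ _ _ that] ext init by auto
  have cont': "continuous_on {0..S'} g'" "continuous_on {0..S'} h'"
    using flow_continuous_on[OF ext(5)] by auto
  have near: "\<exists>\<delta>>0. \<forall>r\<in>{0..S'}. \<bar>r - s\<bar> < \<delta> \<longrightarrow> \<bar>\<phi> r - \<phi> s\<bar> < e"
    if "continuous_on {0..S'} \<phi>" "e > 0" for \<phi> :: "real \<Rightarrow> real" and e
  proof -
    have "s \<in> {0..S'}" using s0 ext(1) by simp
    with that show ?thesis unfolding continuous_on_iff dist_real_def by blast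
  qed
  show False
  proof (cases "h s < 0")
    case True
    then have "g s \<le> 0" using s(2) by (auto simp: m_def)
    obtain \<delta> where \<delta>: "\<delta> > 0" "\<And>r. r \<in> {0..S'} \<Longrightarrow> \<bar>r - s\<bar> < \<delta> \<Longrightarrow> \<bar>h' r - h' s\<bar> < - h' s"
      using near[OF cont'(2), of "- h' s"] True eq(3)[of s] s0 by auto
    define u where "u = s + min (\<delta> / 2) (S' - s)"
    have u: "s < u" "u \<le> S'" "u - s < \<delta>" using \<delta>(1) ext(1) by (auto simp: u_def)
    have flu: "flow {0..u} f' g' h'" "flow {s..u} f' g' h'" using flow_subset[OF ext(5)] u s0 by auto
    have h': "h' r < 0" if "r \<in> {0..u}" for r
    proof (cases "r < s")
      case True
      then show ?thesis using eq(3)[of r] before(2)[of r] that by auto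
    next
      case False
      then have "\<bar>h' r - h' s\<bar> < - h' s" using \<delta>(2)[of r] that u s0 by auto
      then show ?thesis by linarith
    qed
    have "g' u < g' s"
    proof -
      obtain e where e: "e > 0" "\<And>r. r \<in> {s..u} \<Longrightarrow> e \<le> - h' r"
        using continuous_pos_lower_bound[of s u "\<lambda>t. - h' t"] flow_continuous_on(3)[OF flu(2)] u h' s0
        by (auto intro: continuous_on_minus)
      have "g' u \<le> g' s + (- e) * (u - s)"
        by (rule increment_le_within[where F = g', OF _ flowD(2)[OF flu(2)]]) (use e u in force)+
      then show ?thesis using e u by (simp add: mult_pos_pos algebra_simps)
          (smt (verit) mult_strict_left_mono)
    qed
    then have "g' u < 0" using eq(2)[of s] \<open>g s \<le> 0\<close> s0 by simp
    then have "descending f0 A u f' g' h'" using flu(1) ext h' u s0 by (simp add: descending_def)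
    then show False using notin unfolding descent_slopes_def by blast
  next
    case False
    then have "h s \<ge> 0" by simp
    then have "s \<noteq> 0" using init by auto
    then have "s > 0" using s0 by simp
    obtain u where u: "0 < u" "u \<le> s" "- h u = 0"
      using first_zero[of 0 s "\<lambda>t. - h t" s] flow_continuous_on(3)[OF fls] init \<open>h s \<ge> 0\<close> s0
      by (auto intro: continuous_on_minus)
    then have "u = s" using before(2)[of u] by (cases "u < s") auto
    then have hs: "h s = 0" using u by simp
    have gs: "g s > 0"
    proof (rule ccontr)
      assume "\<not> g s > 0"
      then obtain v where v: "0 < v" "v \<le> s" "g v = 0"
        using first_zero[of 0 s g s] flow_continuous_on(2)[OF fls] before(1)[of 0] \<open>s > 0\<close> by auto
      then have "v = s" using before(1)[of v] by (cases "v < s") auto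
      then show False using no_rest_point[OF fls s0 _ hs] v init by simp
    qed
    obtain \<delta> where \<delta>: "\<delta> > 0" "\<And>r. r \<in> {0..S'} \<Longrightarrow> \<bar>r - s\<bar> < \<delta> \<Longrightarrow> \<bar>g' r - g' s\<bar> < g' s"
      using near[OF cont'(1), of "g' s"] gs eq(2)[of s] s0 by auto
    have "s \<in> {0..S'}" using s0 ext(1) by simp
    have "b * (g' s)\<^sup>2 - c * f' s * h' s > 0" using eq[of s] s0 hs gs params by simp
    from has_real_derivative_pos_inc_right[OF flowD(3)[OF ext(5) \<open>s \<in> {0..S'}\<close>] this]
    obtain \<eta> where \<eta>: "\<eta> > 0" "\<And>k. k > 0 \<Longrightarrow> s + k \<in> {0..S'} \<Longrightarrow> k < \<eta> \<Longrightarrow> h' s < h' (s + k)"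
      by auto
    define k where "k = min (min (\<delta> / 2) (\<eta> / 2)) (S' - s)"
    have k: "k > 0" "k < \<delta>" "k < \<eta>" "s + k \<le> S'" using \<delta>(1) \<eta>(1) ext(1) by (auto simp: k_def)
    define u where "u = s + k"
    have hu: "h' u > 0" using \<eta>(2)[of k] k s0 eq(3)[of s] hs by (simp add: u_def)
    have gu: "g' r > 0" if "r \<in> {0..u}" for r
    proof (cases "r < s")
      case True
      then show ?thesis using eq(2)[of r] before(1)[of r] that by auto
    next
      case False
      then have "\<bar>g' r - g' s\<bar> < g' s" using \<delta>(2)[of r] that k s0 by (auto simp: u_def)
      then show ?thesis by linarith
    qed
    have flu: "flow {0..u} f' g' h'" and u0: "u \<ge> 0" using flow_subset[OF ext(5)] k s0 by (auto simp: u_def)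
    obtain e where e: "e > 0" "\<And>r. r \<in> {0..u} \<Longrightarrow> e \<le> g' r"
      using continuous_pos_lower_bound[OF flow_continuous_on(2)[OF flu] u0 gu] by blast
    define e' where "e' = min e (h' u)"
    have "e' > 0" using e(1) hu by (simp add: e'_def)
    obtain d where d: "d > 0" "\<And>a. \<bar>a - g' 0\<bar> < d \<Longrightarrow> \<exists>S'' f'' g'' h''. nearby_flow u e' f' g' h' a S'' f'' g'' h''"
      using ex_nearby_flow[OF flu u0 \<open>e' > 0\<close>] by blast
    have "A - d < Sup (descent_slopes f0)" using sup d(1) by simp
    then obtain a where a: "a \<in> descent_slopes f0" "A - d < a" using less_cSupE[OF _ ne] by blast
    have "a \<le> A" using cSup_upper[OF a(1) bdd] unfolding sup[symmetric] .
    then have "\<bar>a - g' 0\<bar> < d" using a(2) ext(3) by simp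
    then obtain S'' f'' g'' h'' where "nearby_flow u e' f' g' h' a S'' f'' g'' h''" using d(2) by blast
    then have y: "S'' > u" "f'' 0 = f0" "g'' 0 = a" "h'' 0 = - 1" "flow {0..S''} f'' g'' h''"
       "\<And>t. t \<in> {0..u} \<Longrightarrow> \<bar>g'' t - g' t\<bar> < e \<and> \<bar>h'' t - h' t\<bar> < h' u"
      by (auto simp: nearby_flow_def e'_def ext)
    obtain T p q r where D: "descending f0 a T p q r" using a by (auto simp: descent_slopes_def)
    then have D': "T \<ge> 0" "flow {0..T} p q r" "p 0 = f0" "q 0 = a" "r 0 = - 1" "\<And>t. t \<in> {0..T} \<Longrightarrow> r t < 0" "q T < 0"
      by (auto simp: descending_def)
    \<comment> \<open>If the descent of \<open>a\<close> ends by time \<open>u\<close>, it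
      contradicts \<open>g'' > 0\<close> there; if later, \<open>h\<close> would still have to be
      negative at \<open>u\<close>.\<close>
    show False
    proof (cases "T \<le> u")
      case True
      then have T: "T \<in> {0..u}" using D'(1) by simp
      have "q T = g'' T"
        using flow_unique(2)[OF D'(2) flow_subset[OF y(5)], of T] y T D' by auto
      moreover have "g'' T > 0" using y(6)[OF T] e(2)[OF T] by linarith
      ultimately show False using D'(7) by simp
    next
      case False
      have "r u = h'' u"
        using flow_unique(3)[OF flow_subset[OF D'(2)] flow_subset[OF y(5)], of u u] y D' u0 False by auto
      moreover have "h'' u > 0" using y(6)[of u] u0 by force
      ultimately show False using D'(6)[of u] False u0 by auto
    qed
  qed
qed

text \<open>On the critical orbit \<open>g\<close> decreases from \<open>A\<close> but stays
  positive, which bounds \<open>f\<close> and, by \<open>concave_increasing_bounds\<close>, also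
  \<open>h\<close> on each finite horizon.\<close>

lemma critical_flow:
  obtains f g h where "flow {0..} f g h" "f 0 = f0" "g 0 = Sup (descent_slopes f0)" "h 0 = - 1"
    "\<And>t. t \<ge> 0 \<Longrightarrow> g t > 0 \<and> h t < 0"
proof -
  define A where "A = Sup (descent_slopes f0)"
  obtain f g h where fgh: "f 0 = f0" "g 0 = A" "h 0 = - 1" "flow {0..} f g h"
  proof (rule flow_global[of f0 A "- 1"])
    fix S :: real assume S: "S \<ge> 0"
    define k where "k = c * \<bar>f0\<bar>"
    have k: "k \<ge> 0" using params by (simp add: k_def)
    have "\<bar>f T\<bar> \<le> \<bar>f0\<bar> + A * S + A + exp (k * S) \<and> \<bar>g T\<bar> \<le> \<bar>f0\<bar> + A * S + A + exp (k * S)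
        \<and> \<bar>h T\<bar> \<le> \<bar>f0\<bar> + A * S + A + exp (k * S)"
      if T: "T \<in> {0..S}" and init: "f 0 = f0" "g 0 = A" "h 0 = - 1" and fl: "flow {0..T} f g h" for T f g h
    proof -
      have sgn: "g t > 0 \<and> h t < 0" if "t \<in> {0..T}" for t
        using critical_slope_flow[OF A_def fl init that] .
      have TT: "T \<in> {0..T}" "0 \<in> {0..T}" using T by auto
      have lower: "f0 \<le> f T" "- exp (k * T) \<le> h T"
        using concave_increasing_bounds[OF fl init(3) _ TT(1)] sgn by (auto simp: init k_def less_imp_le)
      have g: "g t \<le> A" if t: "t \<in> {0..T}" for t
      proof -
        have flt: "flow {0..t} f g h" using flow_subset[OF fl] t by simp
        have "g t \<le> g 0"
          by (rule nonincreasing_within[where F = g, OF _ flowD(2)[OF flt]]) (use sgn t in \<open>auto intro: less_imp_le\<close>)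
        then show ?thesis by (simp add: init)
      qed
      have "f T \<le> f 0 + A * (T - 0)"
        by (rule increment_le_within[where F = f, OF _ flowD(1)[OF fl]]) (use g T in auto)
      then have upper: "f T \<le> f0 + A * T" by (simp add: init)
      have "A > 0" using sgn[OF TT(2)] by (simp add: init)
      then have AT: "A * T \<le> A * S" "0 \<le> A * T" using T by (auto intro: mult_left_mono)
      have "k * T \<le> k * S" using T k by (intro mult_left_mono) auto
      then have "exp (k * T) \<le> exp (k * S)" by simp
      moreover have "0 < exp (k * S)" by simp
      ultimately show ?thesis using lower upper AT g[OF TT(1)] sgn[OF TT(1)] \<open>A > 0\<close>
        by (intro conjI) linarith+
    qed
    then show "\<exists>R. \<forall>T\<in>{0..S}. \<forall>f g h. f 0 = f0 \<longrightarrow> g 0 = A \<longrightarrow> h 0 = - 1 \<longrightarrow>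
       flow {0..T} f g h \<longrightarrow> \<bar>f T\<bar> \<le> R \<and> \<bar>g T\<bar> \<le> R \<and> \<bar>h T\<bar> \<le> R" by blast
  qed
  have "g t > 0 \<and> h t < 0" if "t \<ge> 0" for t
    using critical_slope_flow[OF A_def flow_subset[OF fgh(4), of "{0..t}"] fgh(1-3), of t] that by auto
  then show ?thesis using fgh that unfolding A_def by blast
qed

text \<open>On the critical orbit \<open>h\<close> cannot stay below a negative constant, because
  \<open>g\<close> remains positive. At a late \<open>T\<close> all required inequalities are
  strict, so they pass to nearby slopes.\<close>

lemma near_critical:
  assumes "l > 0"
  obtains T d where "T \<ge> 0" "d > 0"
    "\<And>a. \<bar>a - Sup (descent_slopes f0)\<bar> < d \<Longrightarrow> \<exists>f g h. flow {0..T} f g h \<and> f 0 = f0 \<and> g 0 = a \<and> h 0 = - 1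
      \<and> (\<forall>t\<in>{0..T}. h t < 0) \<and> f T > 0 \<and> g T > 0 \<and> - h T < l * f T ^ 3"
proof -
  define A where "A = Sup (descent_slopes f0)"
  obtain f g h where fl: "flow {0..} f g h" and init: "f 0 = f0" "g 0 = A" "h 0 = - 1"
    and sgn: "\<And>t. t \<ge> 0 \<Longrightarrow> g t > 0 \<and> h t < 0"
    using critical_flow[of f0] unfolding A_def by blast
  have flS: "flow {s..t} f g h" if "s \<ge> 0" for s t
    using that by (intro flow_subset[OF fl]) auto
  obtain T1 where T1: "T1 \<ge> 0" "f T1 > 0"
    using no_concave_solution_below_zero[OF fl] sgn by (meson not_less)
  \<comment> \<open>As \<open>f\<close> increases along the critical orbit, halving
    \<open>f T1\<close> leaves room for the perturbation of \<open>f T\<close>.\<close>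
  define \<eta> where "\<eta> = l * (f T1 / 2) ^ 3"
  have "\<eta> > 0" using T1 assms by (simp add: \<eta>_def)
  have "\<exists>T\<ge>T1. - h T < \<eta>"
  proof (rule ccontr)
    assume "\<not> ?thesis"
    then have h: "h t \<le> - \<eta>" if "t \<ge> T1" for t using that by force
    define t where "t = T1 + g T1 / \<eta>"
    have "g T1 > 0" using sgn T1 by simp
    then have t: "T1 \<le> t" using \<open>\<eta> > 0\<close> by (simp add: t_def)
    have "g t \<le> g T1 + (- \<eta>) * (t - T1)"
      by (rule increment_le_within[where F = g, OF t flowD(2)[OF flS[OF T1(1)]]]) (use h in auto)
    also have "\<dots> = 0" using \<open>\<eta> > 0\<close> by (simp add: t_def)
    finally show False using sgn[of t] t T1 by simp
  qed
  then obtain T where T: "T \<ge> T1" "- h T < \<eta>" by blast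
  have T0: "T \<ge> 0" using T T1 by simp
  have flT: "flow {0..T} f g h" using flS by simp
  have "f T1 \<le> f T"
  proof (rule nondecreasing_within[where F = f, OF T(1) flowD(1)[OF flS[OF T1(1)]]])
    show "g t \<ge> 0" if "t \<in> {T1..T}" for t using sgn[of t] T1(1) that by simp
  qed
  obtain e1 where e1: "e1 > 0" "\<And>t. t \<in> {0..T} \<Longrightarrow> e1 \<le> - h t"
    using continuous_pos_lower_bound[of 0 T "\<lambda>t. - h t"] flow_continuous_on(3)[OF flS[of 0 T]] T0 sgn
    by (auto intro: continuous_on_minus)
  define e where "e = min (min (f T1 / 2) (\<eta> + h T)) (min (g T) e1)"
  have "e > 0" using T1 T e1 sgn[OF T0] by (auto simp: e_def)
  obtain d where d: "d > 0" "\<And>a. \<bar>a - g 0\<bar> < d \<Longrightarrow> \<exists>S' f' g' h'. nearby_flow T e f g h a S' f' g' h'"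
    using ex_nearby_flow[OF flT T0 \<open>e > 0\<close>] by blast
  show ?thesis
  proof (rule that[OF T0 d(1)])
    fix a assume "\<bar>a - Sup (descent_slopes f0)\<bar> < d"
    then obtain S' f' g' h' where "nearby_flow T e f g h a S' f' g' h'" using d(2)[of a] init by (auto simp: A_def)
    then have y: "S' > T" "f' 0 = f0" "g' 0 = a" "h' 0 = - 1" "flow {0..S'} f' g' h'"
      and near: "\<And>t. t \<in> {0..T} \<Longrightarrow> \<bar>f' t - f t\<bar> < e \<and> \<bar>g' t - g t\<bar> < e \<and> \<bar>h' t - h t\<bar> < e"
      by (auto simp: nearby_flow_def init)
    have le: "e \<le> f T1 / 2" "e \<le> \<eta> + h T" "e \<le> g T" "e \<le> e1"
      unfolding e_def by (simp_all only: min_le_iff_disj order_refl simp_thms)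
    have "flow {0..T} f' g' h'" using flow_subset[OF y(5)] y(1) by simp
    moreover have "\<forall>t\<in>{0..T}. h' t < 0"
    proof
      fix t assume t: "t \<in> {0..T}"
      then show "h' t < 0" using near[OF t] e1(2)[OF t] le by linarith
    qed
    moreover have at_T: "f' T > f T1 / 2" "g' T > 0" "- h' T < \<eta>"
      using near[of T] T0 le \<open>f T1 \<le> f T\<close> by (auto simp: abs_less_iff)
    moreover have "\<eta> \<le> l * f' T ^ 3"
      unfolding \<eta>_def using at_T(1) T1 assms by (intro mult_left_mono power_mono) auto
    ultimately show "\<exists>f g h. flow {0..T} f g h \<and> f 0 = f0 \<and> g 0 = a \<and> h 0 = - 1
      \<and> (\<forall>t\<in>{0..T}. h t < 0) \<and> f T > 0 \<and> g T > 0 \<and> - h T < l * f T ^ 3"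
      using y T1 by (intro exI[of _ f'] exI[of _ g'] exI[of _ h']) auto
  qed
qed

section \<open>Orbits just below the critical slope\<close>

text \<open>Below \<open>ratio_init\<close> so that the convex phase can start, and at most 1/4 for
  the concave phase.\<close>

definition trap_level :: real where "trap_level = min (ratio_init / 2) (1 / 4)"

lemma trap_level: "trap_level > 0" "trap_level < ratio_init" "trap_level \<le> 1 / 4"
  using ratio_init_pos by (auto simp: trap_level_def)

lemma trap_level_init:
  fixes u v w :: real
  assumes "u > 0" "v > 0" "- w < trap_level * u ^ 3"
  shows "- v / u\<^sup>2 - w / u ^ 3 \<le> trap_level"
proof -
  have "- v / u\<^sup>2 \<le> 0" using assms by simp
  moreover have "- w / u ^ 3 \<le> trap_level" using assms by (subst pos_divide_le_eq) auto
  ultimately show ?thesis by simp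
qed

text \<open>Stated for a finite \<open>S\<close> because it also provides the a priori bounds. The
  descending piece gives \<open>g < 0\<close> at the first zero of \<open>h\<close>: by uniqueness
  it belongs to the same orbit, it must end before that zero, and \<open>g\<close> does not increase
  in between.\<close>

lemma descending_dichotomy:
  assumes fl: "flow {0..S} f g h" and T: "0 \<le> T" "T \<le> S"
    and h: "\<forall>t\<in>{0..T}. h t < 0" and at_T: "f T > 0" "g T > 0" "- h T < trap_level * f T ^ 3"
    and D: "descending (f 0) (g 0) T2 f2 g2 h2" and h0: "h 0 = - 1"
  shows "(\<forall>t\<in>{0..S}. h t < 0) \<and> (\<forall>t\<in>{T..S}. f t > 0 \<and> - g t \<le> trap_level * (f t)\<^sup>2) \<or>
    (\<exists>s\<in>{T<..S}. h s = 0 \<and> (\<forall>t\<in>{0..<s}. h t < 0) \<and>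
      (\<forall>t\<in>{s..S}. (s < t \<longrightarrow> h t > 0) \<and> f t > 0 \<and> g t < 0 \<and> - g t \<le> c ^ 3 * (f t)\<^sup>2 \<and> h t \<le> c ^ 3 * f t ^ 3))"
proof -
  note L = trap_level_init[OF at_T]
  have concave: "f t > 0 \<and> - g t \<le> trap_level * (f t)\<^sup>2"
    if "s \<le> S" "\<And>t. t \<in> {T..s} \<Longrightarrow> h t \<le> 0" "t \<in> {T..s}" for s t
    using concave_phase[OF flow_subset[OF fl, of "{T..s}"] at_T(1) L trap_level(3) that(2,3)] that T by auto
  show ?thesis
  proof (cases "\<forall>t\<in>{0..S}. h t < 0")
    case True
    then have "h t \<le> 0" if "t \<in> {T..S}" for t using that T by (auto intro: less_imp_le)
    from concave[OF order_refl this] True show ?thesis by blast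
  next
    case False
    then obtain w where w: "w \<in> {0..S}" "- h w \<le> 0" by force
    obtain s where s: "0 < s" "s \<le> w" "- h s = 0" "\<And>r. r \<in> {0..<s} \<Longrightarrow> - h r > 0"
      using first_zero[of 0 S "\<lambda>t. - h t" w] flow_continuous_on(3)[OF fl] h0 w
      by (auto intro: continuous_on_minus)
    have "T < s"
    proof (rule ccontr)
      assume "\<not> T < s"
      then have "h s < 0" using h s(1) by auto
      then show False using s(3) by simp
    qed
    have "s \<le> S" using s w by auto
    have D': "T2 \<ge> 0" "flow {0..T2} f2 g2 h2" "f2 0 = f 0" "g2 0 = g 0" "h2 0 = h 0"
      "\<And>t. t \<in> {0..T2} \<Longrightarrow> h2 t < 0" "g2 T2 < 0"
      using D h0 by (auto simp: descending_def)
    have "T2 < s"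
    proof (rule ccontr)
      assume "\<not> T2 < s"
      then have "h2 s = h s"
        using flow_unique(3)[OF flow_subset[OF D'(2), of "{0..s}"] flow_subset[OF fl, of "{0..s}"], of s] D' s \<open>s \<le> S\<close> by auto
      then show False using D'(6)[of s] s \<open>\<not> T2 < s\<close> by auto
    qed
    have "g2 T2 = g T2"
      using flow_unique(2)[OF D'(2) flow_subset[OF fl], of T2] D' \<open>T2 < s\<close> \<open>s \<le> S\<close> by auto
    have hs: "h t \<le> 0" if "t \<in> {0..s}" for t using s(3) s(4)[of t] that by (cases "t = s") auto
    have "g s \<le> g T2"
    proof (rule nonincreasing_within[where F = g])
      have "flow {T2..s} f g h" using flow_subset[OF fl] D' \<open>s \<le> S\<close> by simp
      then show "(g has_real_derivative h t) (at t within {T2..s})" if "t \<in> {T2..s}" for t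
        using flowD(2) that by blast
    qed (use \<open>T2 < s\<close> hs D' in auto)
    then have "g s < 0" using D'(7) \<open>g2 T2 = _\<close> by simp
    have cs: "f s > 0" "- g s \<le> trap_level * (f s)\<^sup>2"
      using concave[OF \<open>s \<le> S\<close>, of s] hs T \<open>T < s\<close> by auto
    have "trap_level * (f s)\<^sup>2 < ratio_init * (f s)\<^sup>2"
      using cs trap_level(2) by (intro mult_strict_right_mono) auto
    with cs(2) have "- g s < ratio_init * (f s)\<^sup>2" by (rule order.strict_trans1)
    have fls: "flow {s..S} f g h" using flow_subset[OF fl] s by simp
    have "\<forall>t\<in>{s..S}. (s < t \<longrightarrow> h t > 0) \<and> f t > 0 \<and> g t < 0 \<and> - g t \<le> c ^ 3 * (f t)\<^sup>2 \<and> h t \<le> c ^ 3 * f t ^ 3"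
      using convex_phase[OF fls _ \<open>g s < 0\<close> cs(1) \<open>- g s < ratio_init * _\<close>] s(3) by auto
    moreover have "\<forall>t\<in>{0..<s}. h t < 0" using s(4) by force
    ultimately show ?thesis using s(3) \<open>T < s\<close> \<open>s \<le> S\<close> by (intro disjI2 bexI[of _ s]) auto
  qed
qed

text \<open>These bounds exclude blow-up: \<open>f\<close> grows at most linearly after
  \<open>T\<close> and controls \<open>g\<close> from below and \<open>h\<close> from above. For the
  lower bound on \<open>h\<close>, both terms of its derivative are nonnegative while
  \<open>f > 0 \<ge> h\<close>.\<close>

lemma trapped_bounds:
  assumes fl: "flow {0..S} f g h" and T: "0 \<le> T" "T \<le> S"
    and h: "\<forall>t\<in>{0..T}. h t < 0" and at_T: "f T > 0" "g T > 0" "- h T < trap_level * f T ^ 3"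
    and D: "descending (f 0) (g 0) T2 f2 g2 h2" and h0: "h 0 = - 1"
  shows "0 < f S \<and> f S \<le> f T + g T * (S - T) \<and> - (c ^ 3 * (f S)\<^sup>2) \<le> g S \<and> g S \<le> g T
    \<and> h T \<le> h S \<and> h S \<le> c ^ 3 * f S ^ 3"
proof -
  have c3: "trap_level \<le> c ^ 3"
  proof -
    have "1 \<le> c ^ 3" using c_gt by simp
    then show ?thesis using trap_level(3) by linarith
  qed
  have concave: "f u \<le> f T + g T * (u - T) \<and> g u \<le> g T \<and> h T \<le> h u"
    if u: "u \<in> {T..S}" and hu: "\<And>t. t \<in> {T..u} \<Longrightarrow> h t \<le> 0" and fu: "\<And>t. t \<in> {T..u} \<Longrightarrow> f t > 0" for u
  proof (intro conjI)
    have flu: "flow {T..v} f g h" if "v \<in> {T..u}" for v using flow_subset[OF fl] T u that by auto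
    have g: "g v \<le> g T" if v: "v \<in> {T..u}" for v
      by (rule nonincreasing_within[where F = g, OF _ flowD(2)[OF flu[OF v]]]) (use v hu in auto)
    have uu: "u \<in> {T..u}" using u by simp
    show "g u \<le> g T" using g[OF uu] .
    show "f u \<le> f T + g T * (u - T)"
      by (rule increment_le_within[where F = f, OF _ flowD(1)[OF flu[OF uu]]]) (use g u in auto)
    show "h T \<le> h u"
    proof (rule nondecreasing_within[where F = h, OF _ flowD(3)[OF flu[OF uu]]])
      fix t assume t: "t \<in> {T..u}"
      have "c * f t * h t \<le> 0" using fu[OF t] hu[OF t] params by (intro mult_nonneg_nonpos) auto
      moreover have "b * (g t)\<^sup>2 \<ge> 0" using params by simp
      ultimately show "0 \<le> b * (g t)\<^sup>2 - c * f t * h t" by linarith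
    qed (use u in auto)
  qed
  from descending_dichotomy[OF assms] show ?thesis
  proof (elim disjE bexE conjE)
    assume neg: "\<forall>t\<in>{0..S}. h t < 0" and pos: "\<forall>t\<in>{T..S}. f t > 0 \<and> - g t \<le> trap_level * (f t)\<^sup>2"
    have fS: "f S > 0" "- g S \<le> trap_level * (f S)\<^sup>2" using pos T by auto
    have "trap_level * (f S)\<^sup>2 \<le> c ^ 3 * (f S)\<^sup>2" using c3 by (intro mult_right_mono) auto
    moreover have "h S < 0" using neg T by auto
    moreover have "c ^ 3 * f S ^ 3 > 0" using fS params by simp
    moreover have "f S \<le> f T + g T * (S - T) \<and> g S \<le> g T \<and> h T \<le> h S"
      by (rule concave) (use neg pos T in \<open>auto intro: less_imp_le\<close>)
    ultimately show ?thesis using fS by linarith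
  next
    fix s assume s: "s \<in> {T<..S}" "h s = 0" "\<forall>t\<in>{0..<s}. h t < 0"
      and after: "\<forall>t\<in>{s..S}. (s < t \<longrightarrow> h t > 0) \<and> f t > 0 \<and> g t < 0 \<and> - g t \<le> c ^ 3 * (f t)\<^sup>2 \<and> h t \<le> c ^ 3 * f t ^ 3"
    have hs: "h t \<le> 0" if "t \<in> {T..s}" for t using s T that by (cases "t = s") (auto intro: less_imp_le)
    note L = trap_level_init[OF at_T]
    have "flow {T..s} f g h" using flow_subset[OF fl] T s by auto
    from concave_phase[OF this at_T(1) L trap_level(3) hs]
    have "f t > 0" if "t \<in> {T..s}" for t using that by blast
    then have at_s: "f s \<le> f T + g T * (s - T)" "h T \<le> h s" using concave[of s] s hs by auto
    have SS: "S \<in> {s..S}" using s by auto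
    have fls: "flow {s..S} f g h" using flow_subset[OF fl] T s by auto
    have "f S \<le> f s"
      by (rule nonincreasing_within[where F = f, OF _ flowD(1)[OF fls]])
         (use s after in \<open>auto intro: less_imp_le\<close>)
    moreover have "g T * (s - T) \<le> g T * (S - T)" using s at_T by (intro mult_left_mono) auto
    moreover have "h T \<le> h S"
    proof (cases "s = S")
      case False
      then have "h S > 0" using after SS by auto
      then show ?thesis using at_s(2) s(2) by simp
    qed (use at_s(2) in simp)
    moreover have "g S < 0" "f S > 0" "- g S \<le> c ^ 3 * (f S)\<^sup>2" "h S \<le> c ^ 3 * f S ^ 3"
      using after SS by auto
    ultimately show ?thesis using at_s(1) at_T by linarith
  qed
qed

lemma trapped_global:
  assumes fl1: "flow {0..T} f1 g1 h1" and T: "0 \<le> T"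
    and h1: "\<forall>t\<in>{0..T}. h1 t < 0" and at_T: "f1 T > 0" "g1 T > 0" "- h1 T < trap_level * f1 T ^ 3"
    and D: "descending (f1 0) (g1 0) T2 f2 g2 h2" and h0: "h1 0 = - 1"
  obtains f g h s where "flow {0..} f g h" "f 0 = f1 0" "g 0 = g1 0" "h 0 = - 1" "s > 0" "h s = 0"
    "\<And>t. t \<in> {0..<s} \<Longrightarrow> h t < 0" "\<And>t. t > s \<Longrightarrow> h t > 0" "(g \<longlongrightarrow> 0) at_top"
proof -
  have same: "f t = f1 t" "g t = g1 t" "h t = h1 t"
    if "flow {0..S} f g h" "f 0 = f1 0" "g 0 = g1 0" "h 0 = - 1" "t \<in> {0..T}" "t \<le> S" for S f g h t
    using flow_unique[OF flow_subset[OF that(1), of "{0..t}"] flow_subset[OF fl1, of "{0..t}"], of t] that h0 by auto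
  have trapped: "\<forall>t\<in>{0..T}. h t < 0" "f T > 0" "g T > 0" "- h T < trap_level * f T ^ 3"
    if "flow {0..S} f g h" "f 0 = f1 0" "g 0 = g1 0" "h 0 = - 1" "T \<le> S" for S f g h
    using same[OF that(1-4)] that(5) h1 at_T T by auto
  obtain f g h where fgh: "f 0 = f1 0" "g 0 = g1 0" "h 0 = - 1" "flow {0..} f g h"
  proof (rule flow_global[of "f1 0" "g1 0" "- 1"])
    fix S :: real assume S: "S \<ge> 0"
    have "compact ((\<lambda>t. \<bar>f1 t\<bar> + \<bar>g1 t\<bar> + \<bar>h1 t\<bar>) ` {0..T})"
      by (intro compact_continuous_image continuous_intros flow_continuous_on[OF fl1] compact_Icc)
    from compact_imp_bounded[OF this] obtain M
      where "\<forall>x\<in>(\<lambda>t. \<bar>f1 t\<bar> + \<bar>g1 t\<bar> + \<bar>h1 t\<bar>) ` {0..T}. norm x \<le> M"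
      unfolding bounded_iff ..
    then have M: "\<bar>f1 t\<bar> + \<bar>g1 t\<bar> + \<bar>h1 t\<bar> \<le> M" if "t \<in> {0..T}" for t
      using that by fastforce
    define N where "N = f1 T + g1 T * S"
    have N: "N > 0" using at_T S by (simp add: N_def add_pos_nonneg)
    define R where "R = \<bar>M\<bar> + N + c ^ 3 * N\<^sup>2 + c ^ 3 * N ^ 3"
    have RN: "\<bar>M\<bar> \<le> R" "N \<le> R" "\<bar>M\<bar> + c ^ 3 * N\<^sup>2 \<le> R" "\<bar>M\<bar> + c ^ 3 * N ^ 3 \<le> R"
    proof -
      have "c ^ 3 * N\<^sup>2 \<ge> 0" "c ^ 3 * N ^ 3 \<ge> 0" using N params by auto
      then show "\<bar>M\<bar> \<le> R" "N \<le> R" "\<bar>M\<bar> + c ^ 3 * N\<^sup>2 \<le> R" "\<bar>M\<bar> + c ^ 3 * N ^ 3 \<le> R"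
        using N by (auto simp: R_def)
    qed
    have "\<bar>f t\<bar> \<le> R \<and> \<bar>g t\<bar> \<le> R \<and> \<bar>h t\<bar> \<le> R"
      if t: "t \<in> {0..S}" and init: "f 0 = f1 0" "g 0 = g1 0" "h 0 = - 1" and fl: "flow {0..t} f g h" for t f g h
    proof (cases "t \<le> T")
      case True
      have tT: "t \<in> {0..T}" using True t by simp
      have "f t = f1 t" "g t = g1 t" "h t = h1 t" using same[OF fl init tT] by auto
      then show ?thesis using M[OF tT] RN(1) by linarith
    next
      case False
      then have "T \<le> t" by simp
      note tr = trapped[OF fl init this]
      have D': "descending (f 0) (g 0) T2 f2 g2 h2" using D init by simp
      have bd: "0 < f t \<and> f t \<le> f T + g T * (t - T) \<and> - (c ^ 3 * (f t)\<^sup>2) \<le> g t \<and> g t \<le> g T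
        \<and> h T \<le> h t \<and> h t \<le> c ^ 3 * f t ^ 3"
        using trapped_bounds[OF fl T \<open>T \<le> t\<close> tr D' init(3)] .
      have TT: "T \<in> {0..T}" using T by simp
      have eqT: "f T = f1 T" "g T = g1 T" "h T = h1 T" using same[OF fl init TT \<open>T \<le> t\<close>] by auto
      have "g1 T * (t - T) \<le> g1 T * S" using t T at_T by (intro mult_left_mono) auto
      then have fN: "f t \<le> N" using bd by (simp add: N_def eqT)
      then have "(f t)\<^sup>2 \<le> N\<^sup>2" "f t ^ 3 \<le> N ^ 3" using bd by (auto intro: power_mono)
      then have "c ^ 3 * (f t)\<^sup>2 \<le> c ^ 3 * N\<^sup>2" "c ^ 3 * f t ^ 3 \<le> c ^ 3 * N ^ 3"
        using params by auto
      moreover have "\<bar>g1 T\<bar> \<le> \<bar>M\<bar>" "\<bar>h1 T\<bar> \<le> \<bar>M\<bar>" using M[OF TT] by linarith+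
      moreover have "c ^ 3 * N\<^sup>2 \<ge> 0" "c ^ 3 * N ^ 3 \<ge> 0" using N params by auto
      ultimately show ?thesis using bd fN RN unfolding eqT by (auto simp: abs_le_iff)
    qed
    then show "\<exists>R. \<forall>t\<in>{0..S}. \<forall>f g h. f 0 = f1 0 \<longrightarrow> g 0 = g1 0 \<longrightarrow> h 0 = - 1 \<longrightarrow>
       flow {0..t} f g h \<longrightarrow> \<bar>f t\<bar> \<le> R \<and> \<bar>g t\<bar> \<le> R \<and> \<bar>h t\<bar> \<le> R" by blast
  qed
  have flS: "flow {0..S} f g h" "flow {r..S} f g h" if "r \<ge> 0" for r S
    using that by (auto intro!: flow_subset[OF fgh(4)])
  have D': "descending (f 0) (g 0) T2 f2 g2 h2" using D fgh by simp
  have dich: "(\<forall>t\<in>{0..S}. h t < 0) \<and> (\<forall>t\<in>{T..S}. f t > 0 \<and> - g t \<le> trap_level * (f t)\<^sup>2) \<or>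
    (\<exists>s\<in>{T<..S}. h s = 0 \<and> (\<forall>t\<in>{0..<s}. h t < 0) \<and>
      (\<forall>t\<in>{s..S}. (s < t \<longrightarrow> h t > 0) \<and> f t > 0 \<and> g t < 0 \<and> - g t \<le> c ^ 3 * (f t)\<^sup>2 \<and> h t \<le> c ^ 3 * f t ^ 3))"
    if S: "T \<le> S" for S
    using descending_dichotomy[OF flS(1)[OF order_refl] T S trapped[OF flS(1)[OF order_refl] fgh(1-3) S] D' fgh(3)] .
  \<comment> \<open>Otherwise \<open>g\<close> would stay below its negative value at
    \<open>T2\<close> and push \<open>f\<close> below 0, against its positivity from
    \<open>T\<close> on.\<close>
  have ex: "\<exists>w\<ge>0. h w \<ge> 0"
  proof (rule ccontr)
    assume "\<not> ?thesis"
    then have neg: "h t < 0" if "t \<ge> 0" for t using that by force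
    have pos: "f t > 0" if "t \<ge> T" for t
      using dich[OF that] neg T that by force
    have T2: "T2 \<ge> 0" "g2 T2 < 0" using D by (auto simp: descending_def)
    have "g2 T2 = g T2"
      using flow_unique(2)[of T2 f2 g2 h2 f g h T2] D' fgh flS(1)[of 0 T2] by (auto simp: descending_def)
    define U where "U = max T T2"
    have U: "U \<ge> 0" "U \<ge> T" "U \<ge> T2" using T by (auto simp: U_def)
    have g: "g t \<le> g2 T2" if "t \<ge> U" for t
    proof -
      have "T2 \<le> t" using U that by simp
      have "g t \<le> g T2"
      proof (rule nonincreasing_within[where F = g, OF \<open>T2 \<le> t\<close> flowD(2)[OF flS(2)[OF T2(1)]]])
        show "h u \<le> 0" if "u \<in> {T2..t}" for u using neg[of u] T2(1) that by simp
      qed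
      then show ?thesis using \<open>g2 T2 = g T2\<close> by simp
    qed
    define t where "t = U + f U / - g2 T2"
    have "U \<le> t" using pos[of U] U T2 by (simp add: t_def divide_nonneg_neg)
    have "f t \<le> f U + g2 T2 * (t - U)"
      by (rule increment_le_within[where F = f, OF \<open>U \<le> t\<close> flowD(1)[OF flS(2)[OF U(1)]]]) (use g in auto)
    also have "\<dots> = 0" using T2 by (simp add: t_def)
    finally show False using pos[of t] \<open>U \<le> t\<close> U by simp
  qed
  then obtain w where w: "w \<ge> 0" "h w \<ge> 0" by blast
  then have "\<not> (\<forall>t\<in>{0..max T w}. h t < 0)" by force
  then obtain s where s: "T < s" "h s = 0" "\<forall>t\<in>{0..<s}. h t < 0"
    using dich[of "max T w"] by auto
  \<comment> \<open>The point that the dichotomy yields on each horizon is the first zero of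
    \<open>h\<close>, hence always the same \<open>s\<close>.\<close>
  have after: "(s < t \<longrightarrow> h t > 0) \<and> f t > 0 \<and> g t < 0" if "t \<ge> s" for t
  proof -
    have "s \<in> {0..t}" using s T that by simp
    then have "\<not> (\<forall>u\<in>{0..t}. h u < 0)" using s(2) by (metis less_irrefl)
    moreover have "T \<le> t" using s that by simp
    ultimately obtain s' where s': "s' \<in> {T<..t}" "h s' = 0" "\<forall>u\<in>{0..<s'}. h u < 0"
      "\<forall>u\<in>{s'..t}. (s' < u \<longrightarrow> h u > 0) \<and> f u > 0 \<and> g u < 0 \<and> - g u \<le> c ^ 3 * (f u)\<^sup>2 \<and> h u \<le> c ^ 3 * f u ^ 3"
      using dich[of t] by blast
    have "\<not> s < s'"
    proof
      assume "s < s'"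
      then have "h s < 0" using s'(3) s(1) T by simp
      then show False using s(2) by simp
    qed
    moreover have "\<not> s' < s"
    proof
      assume "s' < s"
      then have "h s' < 0" using s(3) s'(1) T by simp
      then show False using s'(2) by simp
    qed
    ultimately have "s' = s" by simp
    then show ?thesis using s'(4) that by auto
  qed
  have "s \<ge> 0" using s T by simp
  have mono: "g r \<le> g t" if "s \<le> r" "r \<le> t" for r t
  proof (rule nondecreasing_within[where F = g, OF that(2) flowD(2)[OF flS(2)]])
    show "0 \<le> h u" if "u \<in> {r..t}" for u using after[of u] s(2) that \<open>s \<le> r\<close> by (cases "u = s") auto
  qed (use that \<open>s \<ge> 0\<close> in auto)
  have lim: "(g \<longlongrightarrow> 0) at_top"
  proof (rule order_tendstoI)
    fix e :: real assume "0 < e"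
    have "eventually (\<lambda>t. t \<ge> s) at_top" by (rule eventually_ge_at_top)
    then show "eventually (\<lambda>t. g t < e) at_top"
      by eventually_elim (use after \<open>0 < e\<close> in force)
  next
    fix e :: real assume "e < 0"
    have "\<exists>r\<ge>s. e < g r"
    proof (rule ccontr)
      assume "\<not> ?thesis"
      then have g: "g r \<le> e" if "r \<ge> s" for r using that by force
      define t where "t = s + f s / - e"
      have "s \<le> t" using after[of s] \<open>e < 0\<close> by (simp add: t_def divide_nonneg_neg)
      have "f t \<le> f s + e * (t - s)"
        by (rule increment_le_within[where F = f, OF \<open>s \<le> t\<close> flowD(1)[OF flS(2)[OF \<open>s \<ge> 0\<close>]]]) (use g in auto)
      also have "\<dots> = 0" using \<open>e < 0\<close> by (simp add: t_def)
      finally show False using after[of t] \<open>s \<le> t\<close> by simp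
    qed
    then obtain r where r: "r \<ge> s" "e < g r" by blast
    have "eventually (\<lambda>t. t \<ge> r) at_top" by (rule eventually_ge_at_top)
    then show "eventually (\<lambda>t. e < g t) at_top"
      by eventually_elim (use mono r in force)
  qed
  show ?thesis
    using that[OF fgh(4,1,2,3) _ s(2) _ _ lim] s T after by auto
qed

lemma infinitely_many_slopes:
  "infinite {a. \<exists>f g h s. flow {0..} f g h \<and> f 0 = f0 \<and> g 0 = a \<and> h 0 = - 1 \<and> s > 0 \<and> h s = 0
     \<and> (\<forall>t\<in>{0..<s}. h t < 0) \<and> (\<forall>t>s. h t > 0) \<and> (g \<longlongrightarrow> 0) at_top}" (is "infinite ?G")
proof -
  define A where "A = Sup (descent_slopes f0)"
  obtain T d where T: "T \<ge> 0" and d: "d > 0"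
    and near: "\<And>a. \<bar>a - A\<bar> < d \<Longrightarrow> \<exists>f g h. flow {0..T} f g h \<and> f 0 = f0 \<and> g 0 = a \<and> h 0 = - 1
      \<and> (\<forall>t\<in>{0..T}. h t < 0) \<and> f T > 0 \<and> g T > 0 \<and> - h T < trap_level * f T ^ 3"
    using near_critical[OF trap_level(1), of f0] unfolding A_def by blast
  have sub: "descent_slopes f0 \<inter> {A - d<..<A} \<subseteq> ?G"
  proof
    fix a assume a: "a \<in> descent_slopes f0 \<inter> {A - d<..<A}"
    then have "\<bar>a - A\<bar> < d" by auto
    then obtain f1 g1 h1 where 1: "flow {0..T} f1 g1 h1" "f1 0 = f0" "g1 0 = a" "h1 0 = - 1"
      "\<forall>t\<in>{0..T}. h1 t < 0" "f1 T > 0" "g1 T > 0" "- h1 T < trap_level * f1 T ^ 3"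
      using near by blast
    obtain T2 f2 g2 h2 where "descending (f1 0) (g1 0) T2 f2 g2 h2"
      using a 1 by (auto simp: descent_slopes_def)
    then obtain f g h s where "flow {0..} f g h" "f 0 = f1 0" "g 0 = g1 0" "h 0 = - 1" "s > 0" "h s = 0"
      "\<And>t. t \<in> {0..<s} \<Longrightarrow> h t < 0" "\<And>t. t > s \<Longrightarrow> h t > 0" "(g \<longlongrightarrow> 0) at_top"
      using trapped_global[OF 1(1) T 1(5-8) _ 1(4)] by blast
    then show "a \<in> ?G" using 1(2,3) by blast
  qed
  note ne = descent_slopes_nonempty[of f0] and bdd = bdd_above_descent_slopes[of f0]
  have "A \<notin> descent_slopes f0"
    using Sup_descent_slopes_notin unfolding A_def .
  have next_slope: "\<exists>a \<in> descent_slopes f0 \<inter> {A - d<..<A}. x < a" if "x < A" for x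
  proof -
    have "max x (A - d) < Sup (descent_slopes f0)" using that d by (simp add: A_def)
    then obtain a where a: "a \<in> descent_slopes f0" "max x (A - d) < a" using less_cSupE[OF _ ne] by blast
    moreover have "a \<le> A" using cSup_upper[OF a(1) bdd] unfolding A_def .
    then have "a < A" using a(1) \<open>A \<notin> _\<close> by (cases "a = A") auto
    ultimately show ?thesis by auto
  qed
  have "infinite (descent_slopes f0 \<inter> {A - d<..<A})" (is "infinite ?B")
  proof
    assume fin: "finite ?B"
    have "?B \<noteq> {}" using next_slope[of "A - 1"] by auto
    then have "Max ?B \<in> ?B" using fin by (intro Max_in)
    then obtain a where "a \<in> ?B" "Max ?B < a" using next_slope[of "Max ?B"] by auto
    then show False using Max_ge[OF fin, of a] by auto
  qed
  with sub show ?thesis by (rule infinite_super)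
qed

end

section \<open>Solutions of the boundary value problem\<close>

text \<open>Agreement on the half-line suffices because derivatives are taken within it, and they
  are unique since \<open>t\<close> is a limit point from the right.\<close>

lemma half_line_deriv_eq:
  assumes "(f has_real_derivative D) (at t within {0..})" "t \<ge> 0"
    "\<And>x. x \<ge> 0 \<Longrightarrow> F x = f x"
  shows "(F has_real_derivative D) (at t within {0..})" "half_line_deriv F t = D"
proof -
  show *: "(F has_real_derivative D) (at t within {0..})"
    using assms has_vector_derivative_transform[of t "{0..}" F f D]
    by (simp add: has_real_derivative_iff_has_vector_derivative)
  have "at t within {0..} \<noteq> bot"
  proof -
    have "{t<..} \<subseteq> {0..}" using assms(2) by auto
    from at_le[OF this, of t] show ?thesis using trivial_limit_at_right_real[of t] by (auto simp: bot_unique)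
  qed
  then show "half_line_deriv F t = D"
    unfolding half_line_deriv_def
    using * by (intro vector_derivative_within) (auto simp: has_real_derivative_iff_has_vector_derivative)
qed

lemma (in similarity_flow) flow_half_line_derivs:
  assumes "flow {0..} f g h"
  defines "F \<equiv> restrict f {0..}"
  shows "three_times_differentiable F"
    and "t \<ge> 0 \<Longrightarrow> half_line_deriv F t = g t"
    and "t \<ge> 0 \<Longrightarrow> (half_line_deriv ^^ 2) F t = h t"
    and "t \<ge> 0 \<Longrightarrow> (half_line_deriv ^^ 3) F t = b * (g t)\<^sup>2 - c * f t * h t"
proof -
  note D = flowD[OF assms(1)]
  have 1: "(F has_real_derivative g t) (at t within {0..})" "half_line_deriv F t = g t" if "t \<ge> 0" for t
    using half_line_deriv_eq[OF D(1), of t F] that by (auto simp: F_def)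
  have 2: "(half_line_deriv F has_real_derivative h t) (at t within {0..})"
    "(half_line_deriv ^^ 2) F t = h t" if "t \<ge> 0" for t
    using half_line_deriv_eq[OF D(2), of t "half_line_deriv F"] 1 that by (auto simp: eval_nat_numeral)
  have 3: "((half_line_deriv ^^ 2) F has_real_derivative b * (g t)\<^sup>2 - c * f t * h t) (at t within {0..})"
    "(half_line_deriv ^^ 3) F t = b * (g t)\<^sup>2 - c * f t * h t" if "t \<ge> 0" for t
    using half_line_deriv_eq[OF D(3), of t "(half_line_deriv ^^ 2) F"] 2 that by (auto simp: eval_nat_numeral)
  show "t \<ge> 0 \<Longrightarrow> half_line_deriv F t = g t"
    "t \<ge> 0 \<Longrightarrow> (half_line_deriv ^^ 2) F t = h t"
    "t \<ge> 0 \<Longrightarrow> (half_line_deriv ^^ 3) F t = b * (g t)\<^sup>2 - c * f t * h t"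
    using 1 2 3 by auto
  have diff: "G differentiable_on {0..}"
    if "\<And>t. t \<ge> 0 \<Longrightarrow> (G has_real_derivative D t) (at t within {0..})" for G D :: "real \<Rightarrow> real"
    unfolding differentiable_on_def
    using that by (auto simp: real_differentiable_def)
  show "three_times_differentiable F"
    unfolding three_times_differentiable_def
  proof (intro allI impI)
    fix k :: nat assume "k < 3"
    then consider "k = 0" | "k = 1" | "k = 2" by linarith
    then show "(half_line_deriv ^^ k) F differentiable_on {0..}"
      using diff[OF 1(1)] diff[OF 2(1)] diff[OF 3(1)] by cases auto
  qed
qed

theorem theorem3p8:
  fixes m \<gamma> :: real
  assumes "m > 1"
  shows "infinite {f. bvp_solution m \<gamma> f \<and> concave_convex f}"
proof -
  interpret similarity_flow "2 * m + 1" "m + 2"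
    by unfold_locales (use assms in auto)
  let ?S = "{f. bvp_solution m \<gamma> f \<and> concave_convex f}"
  let ?G = "{a. \<exists>f g h s. flow {0..} f g h \<and> f 0 = - \<gamma> \<and> g 0 = a \<and> h 0 = - 1 \<and> s > 0 \<and> h s = 0
     \<and> (\<forall>t\<in>{0..<s}. h t < 0) \<and> (\<forall>t>s. h t > 0) \<and> (g \<longlongrightarrow> 0) at_top}"
  \<comment> \<open>The slope at 0 tells solutions apart: finitely many solutions would have only
    finitely many slopes.\<close>
  have "?G \<subseteq> (\<lambda>f. half_line_deriv f 0) ` ?S"
  proof
    fix a assume "a \<in> ?G"
    then obtain f g h s where fgh: "flow {0..} f g h" "f 0 = - \<gamma>" "g 0 = a" "h 0 = - 1" "s > 0" "h s = 0"
      "\<forall>t\<in>{0..<s}. h t < 0" "\<forall>t>s. h t > 0" "(g \<longlongrightarrow> 0) at_top" by blast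
    \<comment> \<open>Restriction sets the values at negative times to \<open>undefined\<close>, as
      membership in \<open>extensional {0..}\<close> demands.\<close>
    define F where "F = restrict f {0..}"
    note F = flow_half_line_derivs[OF fgh(1), folded F_def]
    have F_f: "F t = f t" if "t \<ge> 0" for t using that by (simp add: F_def)
    have "eventually (\<lambda>t. g t = half_line_deriv F t) at_top"
      using eventually_ge_at_top[of 0] by eventually_elim (simp add: F(2))
    with fgh(9) have "(half_line_deriv F \<longlongrightarrow> 0) at_top" by (rule Lim_transform_eventually)
    then have "bvp_solution m \<gamma> F"
      unfolding bvp_solution_def
      using F fgh F_f by (auto simp: F_def)
    moreover have "concave_convex F"
      unfolding concave_convex_def
      using F(3) fgh by (intro exI[of _ s]) auto
    moreover have "half_line_deriv F 0 = a" using F(2)[of 0] fgh(3) by simp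
    ultimately show "a \<in> (\<lambda>f. half_line_deriv f 0) ` ?S" by force
  qed
  then show ?thesis
    using infinitely_many_slopes[of "- \<gamma>"] finite_surj by blast
qed

end
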